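(* Let $K$ be a compact hyperbolic attractor of the flow $f^t$ of a smooth vector field $F$ with $F\ne0$ on $K$; let $\mathcal{O}$ be an orbit on $K$, and, for the statement on $K$, let $K$ be a mixing axiom A attractor with physical measure $\rho$. Write $(A,\mathcal{A})$ for $(A(\mathcal{O}),\mathcal{A}(\mathcal{O}))$ or $(A(K),\mathcal{A}(K))$. For $(\omega,\psi)\in\mathcal{A}$, all $(v,\eta)$ in an equivalence class in $A$ give the same product $\langle\!\langle v,\eta;\omega,\psi\rangle\!\rangle$, on $\mathcal{O}$ and on $K$. Hence $\langle\!\langle S(X);\omega,\psi\rangle\!\rangle$ is also well-defined.
   Context: Setting. $\mathcal{M}$ is a smooth Riemannian manifold and $f^t$ is the flow of a smooth vector field $F$. $K$ is a compact hyperbolic attractor with $F\neq0$ on $K$: there is a continuous $f_*$-invariant splitting $T_K\mathcal{M}=V^s\oplus V^u\oplus V^c$, $V^c=\mathrm{span}(F)$, and constants $C>0$, $0<\lambda<1$ with $|f_*^{-t}|_{V^u}|,|f_*^t|_{V^s}|\le C\lambda^t$ for $t\ge0$; and there is an open neighborhood $U$ of $K$ with $\bigcap_{t\ge0}f^tU=K$. "Mixing axiom A attractor" has its usual meaning, and its physical (SRB) measure $\rho$ is the invariant probability on $K$ such that for every $C^\infty$ $\Phi$ and Lebesgue-a.e. $x\in U$, $\frac1T\int_0^T\Phi(f^tx)dt\to\rho(\Phi):=\int\Phi\,d\rho$. Notation. $\mathcal{L}$ is the Lie derivative, $\nabla$ the Riemannian derivative, $F(\psi)$ the derivative of $\psi$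 along $F$; $\omega v:=\omega(v)$. Spaces on an orbit $\mathcal{O}=\{x_t=f^t(x_0)\}_{t\in\mathbb{R}}$ (with the topology of $\mathbb{R}$; a self-crossing is counted as two points). $\mathcal{X}(\mathcal{O})$, $\mathcal{X}^*(\mathcal{O})$: continuous bounded vector fields, covector fields along $\mathcal{O}$; $\mathcal{X}^1(\mathcal{O})$: bounded vector fields continuously differentiable along $\mathcal{O}$; $C(\mathcal{O})$: bounded continuous functions on $\mathcal{O}$; $C^1(\mathcal{O})$: scalar functions continuously differentiable along $\mathcal{O}$. $A(\mathcal{O}):=\{(v,\eta):v\in\mathcal{X}^1(\mathcal{O}),\eta\in C(\mathcal{O})\}/\sim$ and $\mathcal{A}(\mathcal{O}):=\{(\omega,\psi):\omega\in\mathcal{X}^*(\mathcal{O}),\psi\in C^1(\mathcal{O}),F(\psi)=\omega(F)\}$. Spaces on $K$. $\mathcal{X}^\alpha(K)$, $\mathcal{X}^{*\alpha}(K)$, $C^\alpha(K)$: Hölder continuous vector fields, covector fields, functions on $K$. $A(K):=\{(v,\eta):v\in\mathcal{X}^\alpha(K),\nabla_Fv\in\mathcal{X}^\alpha(K),\eta\in C^\alpha(K)\}/\sim$ and $\mathcal{A}(K):=\{(\omega,\psi):\omega\in\mathcal{X}^{*\alpha}(K),\psi\in C^\alpha(K),F(\psi)\in C^\alpha(K),F(\psi)=\omega(F)\}$. In both cases $(v_1,\eta_1)\sim(v_2,\eta_2)$ iff $\mathcal{L}_Fv_1+\eta_1F=\mathcal{L}_Fv_2+\eta_2F$. The shadowing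 operator $S:\mathcal{X}(\mathcal{O})\to A(\mathcal{O})$, respectively $S:\mathcal{X}^\alpha(K)\to A(K)$, is $S(X)=[v,\eta]$ where $\mathcal{L}_Fv+\eta F=X$. Products: $$\langle\!\langle v,\eta;\omega,\psi\rangle\!\rangle_{\mathcal{O}}:=\lim_{T\to\infty}\frac1{2T}\int_{-T}^T(\omega v-\eta\psi)\,dt,\qquad\langle\!\langle v,\eta;\omega,\psi\rangle\!\rangle_K:=\rho(\omega v)-\rho(\eta\psi).$$
   Formalization: C^1(O) is taken to consist of bounded functions continuously differentiable along O; for unbounded ψ the claim fails: with ψ(x_t)=t and bounded ω with ω(F)=1, (F,0)~(0,0) but the products are 1 and 0. *)

theory Defs
  imports "HOL-Analysis.Analysis"
begin

section \<open>Smooth Riemannian manifolds\<close>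

text \<open>Iterated Frechet differentiability; only used for open \<open>S\<close>.\<close>

primrec Ck_on :: "nat \<Rightarrow> 'a set \<Rightarrow> ('a::real_normed_vector \<Rightarrow> 'b::real_normed_vector) \<Rightarrow> bool" where
  "Ck_on 0 S h \<longleftrightarrow> continuous_on S h"
| "Ck_on (Suc k) S h \<longleftrightarrow>
     (\<forall>x\<in>S. h differentiable (at x)) \<and> (\<forall>a. Ck_on k S (\<lambda>x. frechet_derivative h (at x) a))"

definition smooth_on :: "'a set \<Rightarrow> ('a::real_normed_vector \<Rightarrow> 'b::real_normed_vector) \<Rightarrow> bool" where
  "smooth_on S h \<longleftrightarrow> (\<forall>k. Ck_on k S h)"

text \<open>A chart is a pair of a domain and a map that is only relevant on this domain.\<close>

type_synonym ('m, 'e) chart = "'m set \<times> ('m \<Rightarrow> 'e)"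

abbreviation chart_dom :: "('m, 'e) chart \<Rightarrow> 'm set" where "chart_dom c \<equiv> fst c"
abbreviation chart_map :: "('m, 'e) chart \<Rightarrow> 'm \<Rightarrow> 'e" where "chart_map c \<equiv> snd c"
abbreviation chart_img :: "('m, 'e) chart \<Rightarrow> 'e set" where "chart_img c \<equiv> chart_map c ` chart_dom c"
abbreviation chart_inv :: "('m, 'e) chart \<Rightarrow> 'e \<Rightarrow> 'm" where
  "chart_inv c \<equiv> inv_into (chart_dom c) (chart_map c)"

text \<open>
  The manifold is the whole type \<open>'m\<close>. Every point \<open>p\<close> has a preferred chart \<open>chart_at M p\<close>, and
  the tangent space at \<open>p\<close> is the model space \<open>'e\<close>, a tangent vector being represented by its
  coordinates in the preferred chart. A vector field is thus a map \<open>'m \<Rightarrow> 'e\<close>, a covector field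
  a map \<open>'m \<Rightarrow> 'e \<Rightarrow> real\<close> that is linear at each point. No continuity in \<open>p\<close> is
  imposed on \<open>chart_at M p\<close>, so regularity of fields must always be read off after passing to the
  coordinates of a fixed chart, by \<open>to_coord\<close> and \<open>of_coord\<close> below.
\<close>

record ('m, 'e) riemannian =
  charts :: "('m, 'e) chart set"
  chart_at :: "'m \<Rightarrow> ('m, 'e) chart"
  metric :: "'m \<Rightarrow> 'e \<Rightarrow> 'e \<Rightarrow> real"

definition to_coord ::
    "('m, 'e::euclidean_space) riemannian \<Rightarrow> ('m, 'e) chart \<Rightarrow> 'm \<Rightarrow> 'e \<Rightarrow> 'e" where
  "to_coord M c p =
     frechet_derivative (chart_map c \<circ> chart_inv (chart_at M p)) (at (chart_map (chart_at M p) p))"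

definition of_coord ::
    "('m, 'e::euclidean_space) riemannian \<Rightarrow> ('m, 'e) chart \<Rightarrow> 'm \<Rightarrow> 'e \<Rightarrow> 'e" where
  "of_coord M c p =
     frechet_derivative (chart_map (chart_at M p) \<circ> chart_inv c) (at (chart_map c p))"

definition metric_coord ::
    "('m, 'e::euclidean_space) riemannian \<Rightarrow> ('m, 'e) chart \<Rightarrow> 'e \<Rightarrow> 'e \<Rightarrow> 'e \<Rightarrow> real" where
  "metric_coord M c q a b =
     (let p = chart_inv c q in metric M p (of_coord M c p a) (of_coord M c p b))"

definition smooth_manifold ::
    "('m::{t2_space, second_countable_topology}, 'e::euclidean_space) riemannian \<Rightarrow> bool" where
  "smooth_manifold M \<longleftrightarrow>
     (\<forall>p. chart_at M p \<in> charts M \<and> p \<in> chart_dom (chart_at M p)) \<and>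
     (\<forall>c\<in>charts M. open (chart_dom c) \<and> open (chart_img c) \<and>
        homeomorphism (chart_dom c) (chart_img c) (chart_map c) (chart_inv c)) \<and>
     (\<forall>c\<in>charts M. \<forall>d\<in>charts M.
        smooth_on (chart_map c ` (chart_dom c \<inter> chart_dom d)) (chart_map d \<circ> chart_inv c))"

definition riemannian_manifold ::
    "('m::{t2_space, second_countable_topology}, 'e::euclidean_space) riemannian \<Rightarrow> bool" where
  "riemannian_manifold M \<longleftrightarrow>
     smooth_manifold M \<and>
     (\<forall>p. bilinear (metric M p) \<and> (\<forall>a b. metric M p a b = metric M p b a) \<and>
          (\<forall>a. a \<noteq> 0 \<longrightarrow> metric M p a a > 0)) \<and>
     (\<forall>c\<in>charts M. \<forall>a b. smooth_on (chart_img c) (\<lambda>q. metric_coord M c q a b))"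

definition tnorm :: "('m, 'e::euclidean_space) riemannian \<Rightarrow> 'm \<Rightarrow> 'e \<Rightarrow> real" where
  "tnorm M p a = sqrt (metric M p a a)"

definition smooth_function ::
    "('m, 'e::euclidean_space) riemannian \<Rightarrow> ('m \<Rightarrow> real) \<Rightarrow> bool" where
  "smooth_function M \<Phi> \<longleftrightarrow> (\<forall>c\<in>charts M. smooth_on (chart_img c) (\<Phi> \<circ> chart_inv c))"

definition smooth_vector_field ::
    "('m, 'e::euclidean_space) riemannian \<Rightarrow> ('m \<Rightarrow> 'e) \<Rightarrow> bool" where
  "smooth_vector_field M F \<longleftrightarrow>
     (\<forall>c\<in>charts M.
        smooth_on (chart_img c) (\<lambda>q. to_coord M c (chart_inv c q) (F (chart_inv c q))))"

definition lebesgue_null :: "('m, 'e::euclidean_space) riemannian \<Rightarrow> 'm set \<Rightarrow> bool" where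
  "lebesgue_null M N \<longleftrightarrow> (\<forall>c\<in>charts M. negligible (chart_map c ` (N \<inter> chart_dom c)))"

text \<open>
  The Christoffel symbols of the Levi-Civita connection as a vector-valued bilinear map:
  \<open>w = \<Gamma>(a, b)\<close> is determined by
  \<open>2 g(w, z) = \<partial>\<^sub>a g(b, z) + \<partial>\<^sub>b g(a, z) - \<partial>\<^sub>z g(a, b)\<close> for all \<open>z\<close>.
\<close>

definition christoffel ::
    "('m, 'e::euclidean_space) riemannian \<Rightarrow> ('m, 'e) chart \<Rightarrow> 'e \<Rightarrow> 'e \<Rightarrow> 'e \<Rightarrow> 'e" where
  "christoffel M c q a b =
     (THE w. \<forall>z. 2 * metric_coord M c q w z =
          frechet_derivative (\<lambda>q. metric_coord M c q b z) (at q) a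
        + frechet_derivative (\<lambda>q. metric_coord M c q a z) (at q) b
        - frechet_derivative (\<lambda>q. metric_coord M c q a b) (at q) z)"


section \<open>Flows and hyperbolic attractors\<close>

text \<open>\<open>pushforward M f t p\<close> is the derivative of \<open>f\<^sup>t\<close> at \<open>p\<close>, from the tangent space
  at \<open>p\<close> to the one at \<open>f t p\<close>.\<close>

definition pushforward ::
    "('m, 'e::euclidean_space) riemannian \<Rightarrow> (real \<Rightarrow> 'm \<Rightarrow> 'm) \<Rightarrow> real \<Rightarrow> 'm \<Rightarrow> 'e \<Rightarrow> 'e" where
  "pushforward M f t p =
     frechet_derivative (chart_map (chart_at M (f t p)) \<circ> f t \<circ> chart_inv (chart_at M p))
       (at (chart_map (chart_at M p) p))"

definition flow_of ::
    "('m::{t2_space, second_countable_topology}, 'e::euclidean_space) riemannian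
      \<Rightarrow> ('m \<Rightarrow> 'e) \<Rightarrow> (real \<Rightarrow> 'm \<Rightarrow> 'm) \<Rightarrow> bool" where
  "flow_of M F f \<longleftrightarrow>
     (\<forall>p. f 0 p = p) \<and> (\<forall>s t p. f (s + t) p = f s (f t p)) \<and>
     continuous_on UNIV (\<lambda>(t, p). f t p) \<and>
     (\<forall>c\<in>charts M. \<forall>d\<in>charts M.
        smooth_on {(t, q). q \<in> chart_img c \<and> f t (chart_inv c q) \<in> chart_dom d}
          (\<lambda>(t, q). chart_map d (f t (chart_inv c q)))) \<and>
     (\<forall>p. ((\<lambda>t. chart_map (chart_at M p) (f t p)) has_vector_derivative F p) (at 0))"

text \<open>Continuity of a family of subspaces, expressed by the continuity of the orthogonal
  projections (in the coordinates of a chart) onto them.\<close>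

definition continuous_subbundle ::
    "('m::topological_space, 'e::euclidean_space) riemannian \<Rightarrow> 'm set \<Rightarrow> ('m \<Rightarrow> 'e set) \<Rightarrow> bool" where
  "continuous_subbundle M K V \<longleftrightarrow>
     (\<forall>p\<in>K. subspace (V p)) \<and>
     (\<forall>c\<in>charts M. \<forall>a.
        continuous_on (K \<inter> chart_dom c) (\<lambda>p. closest_point (to_coord M c p ` V p) a))"

definition hyperbolic_splitting ::
    "('m::topological_space, 'e::euclidean_space) riemannian \<Rightarrow> ('m \<Rightarrow> 'e) \<Rightarrow> (real \<Rightarrow> 'm \<Rightarrow> 'm)
      \<Rightarrow> 'm set \<Rightarrow> ('m \<Rightarrow> 'e set) \<Rightarrow> ('m \<Rightarrow> 'e set) \<Rightarrow> bool" where
  "hyperbolic_splitting M F f K Vs Vu \<longleftrightarrow>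
     continuous_subbundle M K Vs \<and> continuous_subbundle M K Vu \<and>
     continuous_subbundle M K (\<lambda>p. span {F p}) \<and>
     (\<forall>p\<in>K. \<forall>w. \<exists>!(a, b, z). a \<in> Vs p \<and> b \<in> Vu p \<and> z \<in> span {F p} \<and> w = a + b + z) \<and>
     (\<forall>p\<in>K. \<forall>t. pushforward M f t p ` Vs p = Vs (f t p) \<and>
                 pushforward M f t p ` Vu p = Vu (f t p)) \<and>
     (\<exists>C>0. \<exists>\<theta>>0. \<theta> < 1 \<and> (\<forall>p\<in>K. \<forall>t\<ge>0.
        (\<forall>a\<in>Vs p. tnorm M (f t p) (pushforward M f t p a) \<le> C * \<theta> powr t * tnorm M p a) \<and>
        (\<forall>b\<in>Vu p. tnorm M (f (- t) p) (pushforward M f (- t) p b)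
                     \<le> C * \<theta> powr t * tnorm M p b)))"

definition hyperbolic_attractor ::
    "('m::topological_space, 'e::euclidean_space) riemannian \<Rightarrow> ('m \<Rightarrow> 'e) \<Rightarrow> (real \<Rightarrow> 'm \<Rightarrow> 'm)
      \<Rightarrow> 'm set \<Rightarrow> 'm set \<Rightarrow> bool" where
  "hyperbolic_attractor M F f K U \<longleftrightarrow>
     compact K \<and> (\<forall>t. f t ` K = K) \<and> (\<forall>p\<in>K. F p \<noteq> 0) \<and>
     (\<exists>Vs Vu. hyperbolic_splitting M F f K Vs Vu) \<and>
     open U \<and> K \<subseteq> U \<and> (\<Inter>t\<in>{0..}. f t ` U) = K"

text \<open>A topologically mixing basic hyperbolic set in the sense of Bowen and Ruelle that is an
  attractor; topological transitivity follows from mixing.\<close>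

definition mixing_axiom_A_attractor ::
    "('m::topological_space, 'e::euclidean_space) riemannian \<Rightarrow> ('m \<Rightarrow> 'e) \<Rightarrow> (real \<Rightarrow> 'm \<Rightarrow> 'm)
      \<Rightarrow> 'm set \<Rightarrow> 'm set \<Rightarrow> bool" where
  "mixing_axiom_A_attractor M F f K U \<longleftrightarrow>
     hyperbolic_attractor M F f K U \<and>
     K \<subseteq> closure {p \<in> K. \<exists>T>0. f T p = p} \<and>
     (\<forall>A B. open A \<and> open B \<and> A \<inter> K \<noteq> {} \<and> B \<inter> K \<noteq> {} \<longrightarrow>
        (\<exists>t0. \<forall>t\<ge>t0. f t ` (A \<inter> K) \<inter> (B \<inter> K) \<noteq> {}))"

definition physical_measure ::
    "('m::topological_space, 'e::euclidean_space) riemannian \<Rightarrow> (real \<Rightarrow> 'm \<Rightarrow> 'm)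
      \<Rightarrow> 'm set \<Rightarrow> 'm set \<Rightarrow> 'm measure \<Rightarrow> bool" where
  "physical_measure M f K U \<rho> \<longleftrightarrow>
     sets \<rho> = sets borel \<and> emeasure \<rho> UNIV = 1 \<and> emeasure \<rho> K = 1 \<and>
     (\<forall>t. distr \<rho> borel (f t) = \<rho>) \<and>
     (\<forall>\<Phi>. smooth_function M \<Phi> \<longrightarrow>
        (\<exists>N. lebesgue_null M N \<and>
          (\<forall>x\<in>U - N. ((\<lambda>T. 1 / T * integral {0..T} (\<lambda>t. \<Phi> (f t x)))
                         \<longlongrightarrow> (LINT p:K|\<rho>. \<Phi> p)) at_top)))"


section \<open>Objects along an orbit\<close>

text \<open>
  An orbit is given by its parametrization \<open>x t = f t x0\<close>, and objects along it are functions of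
  \<open>t\<close>, so that a self-crossing counts as two points. A vector field along \<open>x\<close> has
  \<open>v t\<close> in the tangent space at \<open>x t\<close>.
\<close>

definition orbits_on :: "(real \<Rightarrow> 'm \<Rightarrow> 'm) \<Rightarrow> 'm set \<Rightarrow> (real \<Rightarrow> 'm) set" where
  "orbits_on f K = (\<lambda>x0 t. f t x0) ` K"

definition vfields_orbit ::
    "('m, 'e::euclidean_space) riemannian \<Rightarrow> (real \<Rightarrow> 'm) \<Rightarrow> (real \<Rightarrow> 'e) set" where
  "vfields_orbit M x =
     {v. (\<exists>B. \<forall>t. tnorm M (x t) (v t) \<le> B) \<and>
         (\<forall>c\<in>charts M. continuous_on {t. x t \<in> chart_dom c} (\<lambda>t. to_coord M c (x t) (v t)))}"

definition vfields1_orbit ::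
    "('m, 'e::euclidean_space) riemannian \<Rightarrow> (real \<Rightarrow> 'm) \<Rightarrow> (real \<Rightarrow> 'e) set" where
  "vfields1_orbit M x =
     {v. (\<exists>B. \<forall>t. tnorm M (x t) (v t) \<le> B) \<and>
         (\<forall>c\<in>charts M.
            (\<lambda>t. to_coord M c (x t) (v t)) C1_differentiable_on {t. x t \<in> chart_dom c})}"

definition covfields_orbit ::
    "('m, 'e::euclidean_space) riemannian \<Rightarrow> (real \<Rightarrow> 'm) \<Rightarrow> (real \<Rightarrow> 'e \<Rightarrow> real) set" where
  "covfields_orbit M x =
     {\<omega>. (\<forall>t. linear (\<omega> t)) \<and> (\<exists>B. \<forall>t a. \<bar>\<omega> t a\<bar> \<le> B * tnorm M (x t) a) \<and>
         (\<forall>c\<in>charts M. \<forall>a.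
            continuous_on {t. x t \<in> chart_dom c} (\<lambda>t. \<omega> t (of_coord M c (x t) a)))}"

text \<open>
  The members of \<open>C1_orbit\<close> are bounded, like those of \<open>bcontfun\<close>. Without this, the product
  would not be well defined: if \<open>\<omega> (F) = 1\<close>, \<open>\<psi> (x\<^sub>t) = t\<close>, then \<open>(F, 0)\<close> and \<open>(0, 0)\<close> are
  equivalent but have the products 1 and 0.
\<close>

definition C1_orbit :: "(real \<Rightarrow> real) set" where
  "C1_orbit = {\<psi> \<in> bcontfun. \<psi> C1_differentiable_on UNIV}"

text \<open>The Lie derivative of \<open>v\<close> along the flow at \<open>x t\<close>: the derivative at \<open>s = 0\<close> of the
  pullbacks of \<open>v (t + s)\<close> by \<open>f\<^sup>s\<close>, which all lie in the tangent space at \<open>x t\<close>.\<close>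

definition lie_orbit ::
    "('m, 'e::euclidean_space) riemannian \<Rightarrow> (real \<Rightarrow> 'm \<Rightarrow> 'm) \<Rightarrow> (real \<Rightarrow> 'm)
      \<Rightarrow> (real \<Rightarrow> 'e) \<Rightarrow> real \<Rightarrow> 'e" where
  "lie_orbit M f x v t =
     vector_derivative (\<lambda>s. pushforward M f (- s) (x (t + s)) (v (t + s))) (at 0)"

definition shadow_pairs_orbit ::
    "('m, 'e::euclidean_space) riemannian \<Rightarrow> (real \<Rightarrow> 'm) \<Rightarrow> ((real \<Rightarrow> 'e) \<times> (real \<Rightarrow> real)) set" where
  "shadow_pairs_orbit M x = vfields1_orbit M x \<times> bcontfun"

definition shadow_rel_orbit ::
    "('m, 'e::euclidean_space) riemannian \<Rightarrow> ('m \<Rightarrow> 'e) \<Rightarrow> (real \<Rightarrow> 'm \<Rightarrow> 'm) \<Rightarrow> (real \<Rightarrow> 'm)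
      \<Rightarrow> ((real \<Rightarrow> 'e) \<times> (real \<Rightarrow> real)) rel" where
  "shadow_rel_orbit M F f x =
     {((v1, \<eta>1), (v2, \<eta>2)). (v1, \<eta>1) \<in> shadow_pairs_orbit M x \<and> (v2, \<eta>2) \<in> shadow_pairs_orbit M x \<and>
        (\<forall>t. lie_orbit M f x v1 t + \<eta>1 t *\<^sub>R F (x t) = lie_orbit M f x v2 t + \<eta>2 t *\<^sub>R F (x t))}"

definition A_orbit ::
    "('m, 'e::euclidean_space) riemannian \<Rightarrow> ('m \<Rightarrow> 'e) \<Rightarrow> (real \<Rightarrow> 'm \<Rightarrow> 'm) \<Rightarrow> (real \<Rightarrow> 'm)
      \<Rightarrow> ((real \<Rightarrow> 'e) \<times> (real \<Rightarrow> real)) set set" where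
  "A_orbit M F f x = shadow_pairs_orbit M x // shadow_rel_orbit M F f x"

definition adjoint_orbit ::
    "('m, 'e::euclidean_space) riemannian \<Rightarrow> ('m \<Rightarrow> 'e) \<Rightarrow> (real \<Rightarrow> 'm)
      \<Rightarrow> ((real \<Rightarrow> 'e \<Rightarrow> real) \<times> (real \<Rightarrow> real)) set" where
  "adjoint_orbit M F x =
     {(\<omega>, \<psi>). \<omega> \<in> covfields_orbit M x \<and> \<psi> \<in> C1_orbit \<and> (\<forall>t. deriv \<psi> t = \<omega> t (F (x t)))}"

text \<open>The class of the solutions of \<open>\<L>\<^sub>F v + \<eta> F = X\<close>. It is an element of \<open>A_orbit\<close> as soon as
  there is a solution, see \<open>S_orbit_in_A_orbit\<close>.\<close>

definition S_orbit ::
    "('m, 'e::euclidean_space) riemannian \<Rightarrow> ('m \<Rightarrow> 'e) \<Rightarrow> (real \<Rightarrow> 'm \<Rightarrow> 'm) \<Rightarrow> (real \<Rightarrow> 'm)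
      \<Rightarrow> (real \<Rightarrow> 'e) \<Rightarrow> ((real \<Rightarrow> 'e) \<times> (real \<Rightarrow> real)) set" where
  "S_orbit M F f x X =
     {(v, \<eta>) \<in> shadow_pairs_orbit M x. \<forall>t. lie_orbit M f x v t + \<eta> t *\<^sub>R F (x t) = X t}"

text \<open>The product on an orbit is \<open>None\<close> if the limit does not exist.\<close>

definition product_orbit ::
    "(real \<Rightarrow> 'e) \<Rightarrow> (real \<Rightarrow> real) \<Rightarrow> (real \<Rightarrow> 'e \<Rightarrow> real) \<Rightarrow> (real \<Rightarrow> real) \<Rightarrow> real option" where
  "product_orbit v \<eta> \<omega> \<psi> =
     (let avg = (\<lambda>T. 1 / (2 * T) * integral {- T..T} (\<lambda>t. \<omega> t (v t) - \<eta> t * \<psi> t))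
      in if \<exists>l. (avg \<longlongrightarrow> l) at_top then Some (Lim at_top avg) else None)"

lemma equiv_shadow_rel_orbit: "equiv (shadow_pairs_orbit M x) (shadow_rel_orbit M F f x)"
  by (auto simp: equiv_def refl_on_def sym_def trans_def shadow_rel_orbit_def)

lemma S_orbit_in_A_orbit:
  assumes "S_orbit M F f x X \<noteq> {}"
  shows "S_orbit M F f x X \<in> A_orbit M F f x"
proof -
  obtain v \<eta> where *: "(v, \<eta>) \<in> S_orbit M F f x X"
    using assms by auto
  then have "S_orbit M F f x X = shadow_rel_orbit M F f x `` {(v, \<eta>)}"
    by (auto simp: S_orbit_def shadow_rel_orbit_def)
  with * show ?thesis
    by (auto simp: A_orbit_def S_orbit_def intro!: quotientI)
qed


section \<open>Objects on the attractor\<close>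

text \<open>
  Hoelder continuity with exponent \<open>\<alpha>\<close> on \<open>K\<close> of an object whose representation in a chart \<open>c\<close> is
  \<open>h c\<close>, with respect to the distance in the chart. On compact subsets of a chart domain that
  distance is comparable to the Riemannian one. Fields on \<open>K\<close> are total functions whose values
  outside \<open>K\<close> are irrelevant.
\<close>

definition holder_in_charts ::
    "('m::topological_space, 'e::euclidean_space) riemannian \<Rightarrow> real \<Rightarrow> 'm set
      \<Rightarrow> (('m, 'e) chart \<Rightarrow> 'm \<Rightarrow> 'b::real_normed_vector) \<Rightarrow> bool" where
  "holder_in_charts M \<alpha> K h \<longleftrightarrow>
     (\<forall>c\<in>charts M. \<forall>L. compact L \<and> L \<subseteq> K \<inter> chart_dom c \<longrightarrow>
        (\<exists>C. \<forall>p\<in>L. \<forall>q\<in>L. norm (h c p - h c q) \<le> C * dist (chart_map c p) (chart_map c q) powr \<alpha>))"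

definition holder_fun ::
    "('m::topological_space, 'e::euclidean_space) riemannian \<Rightarrow> real \<Rightarrow> 'm set \<Rightarrow> ('m \<Rightarrow> real) set" where
  "holder_fun M \<alpha> K = {\<eta>. holder_in_charts M \<alpha> K (\<lambda>c. \<eta>)}"

definition holder_vfields ::
    "('m::topological_space, 'e::euclidean_space) riemannian \<Rightarrow> real \<Rightarrow> 'm set \<Rightarrow> ('m \<Rightarrow> 'e) set" where
  "holder_vfields M \<alpha> K = {v. holder_in_charts M \<alpha> K (\<lambda>c p. to_coord M c p (v p))}"

definition holder_covfields ::
    "('m::topological_space, 'e::euclidean_space) riemannian \<Rightarrow> real \<Rightarrow> 'm set
      \<Rightarrow> ('m \<Rightarrow> 'e \<Rightarrow> real) set" where
  "holder_covfields M \<alpha> K =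
     {\<omega>. (\<forall>p\<in>K. linear (\<omega> p)) \<and>
         (\<forall>a. holder_in_charts M \<alpha> K (\<lambda>c p. \<omega> p (of_coord M c p a)))}"

text \<open>Derivatives along \<open>F\<close> at \<open>p\<close> are taken along the curve \<open>s \<mapsto> f s p\<close>. For vector
  fields, coordinates in the preferred chart of \<open>p\<close> are used; at \<open>p\<close> itself they are the identity.\<close>

definition fun_along :: "(real \<Rightarrow> 'm \<Rightarrow> 'm) \<Rightarrow> ('m \<Rightarrow> real) \<Rightarrow> 'm \<Rightarrow> real \<Rightarrow> real" where
  "fun_along f \<psi> p = (\<lambda>s. \<psi> (f s p))"

definition vfield_along ::
    "('m, 'e::euclidean_space) riemannian \<Rightarrow> (real \<Rightarrow> 'm \<Rightarrow> 'm) \<Rightarrow> ('m \<Rightarrow> 'e) \<Rightarrow> 'm \<Rightarrow> real \<Rightarrow> 'e" where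
  "vfield_along M f v p = (\<lambda>s. to_coord M (chart_at M p) (f s p) (v (f s p)))"

definition deriv_along :: "(real \<Rightarrow> 'm \<Rightarrow> 'm) \<Rightarrow> ('m \<Rightarrow> real) \<Rightarrow> 'm \<Rightarrow> real" where
  "deriv_along f \<psi> p = deriv (fun_along f \<psi> p) 0"

definition cov_deriv_along ::
    "('m, 'e::euclidean_space) riemannian \<Rightarrow> ('m \<Rightarrow> 'e) \<Rightarrow> (real \<Rightarrow> 'm \<Rightarrow> 'm) \<Rightarrow> ('m \<Rightarrow> 'e) \<Rightarrow> 'm \<Rightarrow> 'e" where
  "cov_deriv_along M F f v p =
     vector_derivative (vfield_along M f v p) (at 0)
     + christoffel M (chart_at M p) (chart_map (chart_at M p) p) (F p) (v p)"

definition lie_along ::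
    "('m, 'e::euclidean_space) riemannian \<Rightarrow> (real \<Rightarrow> 'm \<Rightarrow> 'm) \<Rightarrow> ('m \<Rightarrow> 'e) \<Rightarrow> 'm \<Rightarrow> 'e" where
  "lie_along M f v p = vector_derivative (\<lambda>s. pushforward M f (- s) (f s p) (v (f s p))) (at 0)"

definition shadow_pairs_attractor ::
    "('m::topological_space, 'e::euclidean_space) riemannian \<Rightarrow> ('m \<Rightarrow> 'e) \<Rightarrow> (real \<Rightarrow> 'm \<Rightarrow> 'm)
      \<Rightarrow> real \<Rightarrow> 'm set \<Rightarrow> (('m \<Rightarrow> 'e) \<times> ('m \<Rightarrow> real)) set" where
  "shadow_pairs_attractor M F f \<alpha> K =
     {(v, \<eta>). v \<in> holder_vfields M \<alpha> K \<and>
        (\<forall>p\<in>K. vfield_along M f v p differentiable (at 0)) \<and>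
        cov_deriv_along M F f v \<in> holder_vfields M \<alpha> K \<and> \<eta> \<in> holder_fun M \<alpha> K}"

definition shadow_rel_attractor ::
    "('m::topological_space, 'e::euclidean_space) riemannian \<Rightarrow> ('m \<Rightarrow> 'e) \<Rightarrow> (real \<Rightarrow> 'm \<Rightarrow> 'm)
      \<Rightarrow> real \<Rightarrow> 'm set \<Rightarrow> (('m \<Rightarrow> 'e) \<times> ('m \<Rightarrow> real)) rel" where
  "shadow_rel_attractor M F f \<alpha> K =
     {((v1, \<eta>1), (v2, \<eta>2)).
        (v1, \<eta>1) \<in> shadow_pairs_attractor M F f \<alpha> K \<and> (v2, \<eta>2) \<in> shadow_pairs_attractor M F f \<alpha> K \<and>
        (\<forall>p\<in>K. lie_along M f v1 p + \<eta>1 p *\<^sub>R F p = lie_along M f v2 p + \<eta>2 p *\<^sub>R F p)}"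

definition A_attractor ::
    "('m::topological_space, 'e::euclidean_space) riemannian \<Rightarrow> ('m \<Rightarrow> 'e) \<Rightarrow> (real \<Rightarrow> 'm \<Rightarrow> 'm)
      \<Rightarrow> real \<Rightarrow> 'm set \<Rightarrow> (('m \<Rightarrow> 'e) \<times> ('m \<Rightarrow> real)) set set" where
  "A_attractor M F f \<alpha> K = shadow_pairs_attractor M F f \<alpha> K // shadow_rel_attractor M F f \<alpha> K"

definition adjoint_attractor ::
    "('m::topological_space, 'e::euclidean_space) riemannian \<Rightarrow> ('m \<Rightarrow> 'e) \<Rightarrow> (real \<Rightarrow> 'm \<Rightarrow> 'm)
      \<Rightarrow> real \<Rightarrow> 'm set \<Rightarrow> (('m \<Rightarrow> 'e \<Rightarrow> real) \<times> ('m \<Rightarrow> real)) set" where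
  "adjoint_attractor M F f \<alpha> K =
     {(\<omega>, \<psi>). \<omega> \<in> holder_covfields M \<alpha> K \<and> \<psi> \<in> holder_fun M \<alpha> K \<and>
        (\<forall>p\<in>K. fun_along f \<psi> p differentiable (at 0)) \<and>
        deriv_along f \<psi> \<in> holder_fun M \<alpha> K \<and> (\<forall>p\<in>K. deriv_along f \<psi> p = \<omega> p (F p))}"

definition S_attractor ::
    "('m::topological_space, 'e::euclidean_space) riemannian \<Rightarrow> ('m \<Rightarrow> 'e) \<Rightarrow> (real \<Rightarrow> 'm \<Rightarrow> 'm)
      \<Rightarrow> real \<Rightarrow> 'm set \<Rightarrow> ('m \<Rightarrow> 'e) \<Rightarrow> (('m \<Rightarrow> 'e) \<times> ('m \<Rightarrow> real)) set" where
  "S_attractor M F f \<alpha> K X =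
     {(v, \<eta>) \<in> shadow_pairs_attractor M F f \<alpha> K. \<forall>p\<in>K. lie_along M f v p + \<eta> p *\<^sub>R F p = X p}"

text \<open>Integrals are taken over \<open>K\<close>, as the integrands need not be measurable outside \<open>K\<close>.\<close>

definition product_attractor ::
    "'m measure \<Rightarrow> 'm set \<Rightarrow> ('m \<Rightarrow> 'e) \<Rightarrow> ('m \<Rightarrow> real) \<Rightarrow> ('m \<Rightarrow> 'e \<Rightarrow> real) \<Rightarrow> ('m \<Rightarrow> real) \<Rightarrow> real" where
  "product_attractor \<rho> K v \<eta> \<omega> \<psi> = (LINT p:K|\<rho>. \<omega> p (v p)) - (LINT p:K|\<rho>. \<eta> p * \<psi> p)"

lemma equiv_shadow_rel_attractor:
  "equiv (shadow_pairs_attractor M F f \<alpha> K) (shadow_rel_attractor M F f \<alpha> K)"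
  by (auto simp: equiv_def refl_on_def sym_def trans_def shadow_rel_attractor_def)

lemma S_attractor_in_A_attractor:
  assumes "S_attractor M F f \<alpha> K X \<noteq> {}"
  shows "S_attractor M F f \<alpha> K X \<in> A_attractor M F f \<alpha> K"
proof -
  obtain v \<eta> where *: "(v, \<eta>) \<in> S_attractor M F f \<alpha> K X"
    using assms by auto
  then have "S_attractor M F f \<alpha> K X = shadow_rel_attractor M F f \<alpha> K `` {(v, \<eta>)}"
    by (auto simp: S_attractor_def shadow_rel_attractor_def)
  with * show ?thesis
    by (auto simp: A_attractor_def S_attractor_def intro!: quotientI)
qed

end

theory Submission
  imports Defs
begin

text \<open>
  Let \<open>w\<close> and \<open>\<xi>\<close> be the differences of two equivalent pairs, so that \<open>\<L>\<^sub>F w = - \<xi> F\<close>. The pullback of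
  \<open>w\<close> along an orbit to its initial point then changes only in the direction of \<open>F\<close>, at the bounded
  rate \<open>- \<xi>\<close>. Hence the stable and unstable parts of \<open>w\<close> are transported by the flow, while the
  coefficient of \<open>F\<close> grows at most linearly; as \<open>w\<close> is bounded, exponential growth of the unstable
  part in the future and of the stable part in the past is impossible, so both vanish. Thus
  \<open>w = \<phi> F\<close> with \<open>\<phi>\<close> bounded and \<open>F(\<phi>) = - \<xi>\<close>, and the integrands of the two products differ by
  \<open>\<phi> \<omega>(F) - \<xi> \<psi> = F(\<phi> \<psi>)\<close>, the derivative of a bounded function along the flow. Its time averages
  tend to zero, and its integral for an invariant measure is zero.
\<close>

section \<open>Tangent maps in charts\<close>

text \<open>The case \<open>h = id\<close> gives the coordinate changes and \<open>h = f t\<close>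
  the pushforward, so one chain rule serves for all. Arbitrary charts are allowed because the
  preferred ones may jump from point to point.\<close>

definition tangent_map ::
    "('m, 'e::euclidean_space) chart \<Rightarrow> ('m, 'e) chart \<Rightarrow> ('m \<Rightarrow> 'm) \<Rightarrow> 'm \<Rightarrow> 'e \<Rightarrow> 'e" where
  "tangent_map c d h p = frechet_derivative (chart_map d \<circ> h \<circ> chart_inv c) (at (chart_map c p))"

definition chart_differentiable ::
    "('m, 'e::euclidean_space) chart \<Rightarrow> ('m, 'e) chart \<Rightarrow> ('m \<Rightarrow> 'm) \<Rightarrow> 'm \<Rightarrow> bool" where
  "chart_differentiable c d h p \<longleftrightarrow>
     (chart_map d \<circ> h \<circ> chart_inv c) differentiable (at (chart_map c p))"

lemma to_coord_eq: "to_coord M c p = tangent_map (chart_at M p) c id p"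
  by (simp add: to_coord_def tangent_map_def)

lemma of_coord_eq: "of_coord M c p = tangent_map c (chart_at M p) id p"
  by (simp add: of_coord_def tangent_map_def)

lemma pushforward_eq:
  "pushforward M f t p = tangent_map (chart_at M p) (chart_at M (f t p)) (f t) p"
  by (simp add: pushforward_def tangent_map_def)

lemma linear_tangent_map:
  "chart_differentiable c d h p \<Longrightarrow> linear (tangent_map c d h p)"
  unfolding chart_differentiable_def tangent_map_def by (rule linear_frechet_derivative)

lemma smooth_on_differentiable: "smooth_on S h \<Longrightarrow> x \<in> S \<Longrightarrow> h differentiable (at x)"
  unfolding smooth_on_def by (metis Ck_on.simps(2))

lemma smooth_on_continuous: "smooth_on S h \<Longrightarrow> continuous_on S h"
  unfolding smooth_on_def by (metis Ck_on.simps(1))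

lemma smooth_on_frechet_derivative_differentiable:
  "smooth_on S h \<Longrightarrow> x \<in> S \<Longrightarrow> (\<lambda>x. frechet_derivative h (at x) a) differentiable (at x)"
  unfolding smooth_on_def by (metis Ck_on.simps(2))

locale riemannian_mfd =
  fixes M :: "('m::{t2_space, second_countable_topology}, 'e::euclidean_space) riemannian"
  assumes riemannian: "riemannian_manifold M"
begin

lemma smooth_manifold: "smooth_manifold M"
  using riemannian by (simp add: riemannian_manifold_def)

lemma chart_at [simp]: "chart_at M p \<in> charts M" "p \<in> chart_dom (chart_at M p)"
  using smooth_manifold by (auto simp: smooth_manifold_def)

lemma
  assumes "c \<in> charts M"
  shows open_chart_dom: "open (chart_dom c)" and open_chart_img: "open (chart_img c)"
    and chart_homeomorphism:
      "homeomorphism (chart_dom c) (chart_img c) (chart_map c) (chart_inv c)"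
  using smooth_manifold assms by (auto simp: smooth_manifold_def)

lemma
  assumes "c \<in> charts M"
  shows chart_inv_chart_map: "p \<in> chart_dom c \<Longrightarrow> chart_inv c (chart_map c p) = p"
    and chart_inv_in_dom: "q \<in> chart_img c \<Longrightarrow> chart_inv c q \<in> chart_dom c"
    and chart_map_chart_inv: "q \<in> chart_img c \<Longrightarrow> chart_map c (chart_inv c q) = q"
    and continuous_on_chart_map: "continuous_on (chart_dom c) (chart_map c)"
    and continuous_on_chart_inv: "continuous_on (chart_img c) (chart_inv c)"
  using chart_homeomorphism[OF assms] unfolding homeomorphism_def by (auto intro: inv_into_into)

lemma open_coord_preimage:
  assumes "c \<in> charts M" "continuous_on UNIV h" "open A"
  shows "open {q \<in> chart_img c. h (chart_inv c q) \<in> A}"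
proof -
  have "continuous_on (chart_img c) (\<lambda>q. h (chart_inv c q))"
    by (rule continuous_on_compose2[OF assms(2) continuous_on_chart_inv[OF assms(1)]]) auto
  from continuous_open_preimage[OF this open_chart_img[OF assms(1)] assms(3)]
  show ?thesis by (simp add: vimage_def Int_def)
qed

lemma chart_differentiable_id:
  assumes "c \<in> charts M" "d \<in> charts M" "p \<in> chart_dom c" "p \<in> chart_dom d"
  shows "chart_differentiable c d id p"
proof -
  have "smooth_on (chart_map c ` (chart_dom c \<inter> chart_dom d)) (chart_map d \<circ> chart_inv c)"
    using smooth_manifold assms by (auto simp: smooth_manifold_def)
  from smooth_on_differentiable[OF this] assms show ?thesis
    by (auto simp: chart_differentiable_def)
qed

text \<open>Passing through the middle chart \<open>d\<close> is legitimate only where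
  \<open>h\<close> stays in \<open>chart_dom d\<close>; by continuity of \<open>h\<close> this
  contains a neighbourhood of the point, which is all that a derivative sees.\<close>

lemma tangent_map_compose:
  assumes c: "c \<in> charts M" "p \<in> chart_dom c" and d: "d \<in> charts M" "h p \<in> chart_dom d"
    and h: "continuous_on UNIV h" "chart_differentiable c d h p"
    and g: "chart_differentiable d e g (h p)"
  shows "tangent_map c e (g \<circ> h) p = tangent_map d e g (h p) \<circ> tangent_map c d h p"
proof -
  let ?A = "chart_map d \<circ> h \<circ> chart_inv c" and ?B = "chart_map e \<circ> g \<circ> chart_inv d"
  let ?S = "{q \<in> chart_img c. h (chart_inv c q) \<in> chart_dom d}"
  have A: "(?A has_derivative tangent_map c d h p) (at (chart_map c p))"
    using h(2) unfolding chart_differentiable_def tangent_map_def frechet_derivative_works .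
  have eq: "?A (chart_map c p) = chart_map d (h p)"
    using c by (simp add: chart_inv_chart_map)
  have B: "(?B has_derivative tangent_map d e g (h p)) (at (?A (chart_map c p)))"
    using g unfolding chart_differentiable_def tangent_map_def frechet_derivative_works eq .
  have S: "open ?S"
    using open_coord_preimage[OF c(1) h(1) open_chart_dom[OF d(1)]] .
  have "(chart_map e \<circ> (g \<circ> h) \<circ> chart_inv c has_derivative
         tangent_map d e g (h p) \<circ> tangent_map c d h p) (at (chart_map c p))"
    by (rule has_derivative_transform_within_open[OF diff_chain_at[OF A B] S])
       (use c d in \<open>auto simp: chart_inv_chart_map\<close>)
  then show ?thesis
    unfolding tangent_map_def[of c e] by (metis frechet_derivative_at)
qed

lemma tangent_map_id:
  assumes "c \<in> charts M" "p \<in> chart_dom c"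
  shows "tangent_map c c id p = id"
proof -
  have "(chart_map c \<circ> id \<circ> chart_inv c has_derivative id) (at (chart_map c p))"
    by (rule has_derivative_transform_within_open[OF has_derivative_id open_chart_img[OF assms(1)]])
       (use assms in \<open>auto simp: chart_map_chart_inv\<close>)
  then show ?thesis
    unfolding tangent_map_def by (metis frechet_derivative_at)
qed

lemma linear_of_coord:
  assumes "c \<in> charts M" "p \<in> chart_dom c"
  shows "linear (of_coord M c p)"
  unfolding of_coord_eq using assms by (auto intro!: linear_tangent_map chart_differentiable_id)

text \<open>Chain rule from the preferred chart to \<open>c\<close> and back.\<close>

lemma of_coord_to_coord:
  assumes "c \<in> charts M" "p \<in> chart_dom c"
  shows "of_coord M c p (to_coord M c p a) = a"
proof -
  have "of_coord M c p \<circ> to_coord M c p = id"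
    unfolding of_coord_eq to_coord_eq
    using tangent_map_compose[of "chart_at M p" p c id "chart_at M p" id] assms
    by (simp add: chart_differentiable_id tangent_map_id continuous_on_id)
  then show ?thesis by (metis comp_apply id_apply)
qed


section \<open>Continuity of fields\<close>

text \<open>The fields live along a map \<open>x\<close>, which is a curve for objects on an orbit and the
  identity for objects on \<open>K\<close>.\<close>

lemma continuous_on_pairing_chart:
  fixes x :: "'t::topological_space \<Rightarrow> 'm"
  assumes c: "c \<in> charts M" "\<And>t. t \<in> S \<Longrightarrow> x t \<in> chart_dom c"
    and lin: "\<And>t. t \<in> S \<Longrightarrow> linear (\<omega> t)"
    and v: "continuous_on S (\<lambda>t. to_coord M c (x t) (v t))"
    and \<omega>: "\<And>a. continuous_on S (\<lambda>t. \<omega> t (of_coord M c (x t) a))"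
  shows "continuous_on S (\<lambda>t. \<omega> t (v t) :: real)"
proof -
  have "\<omega> t (v t) = (\<Sum>b\<in>Basis. (to_coord M c (x t) (v t) \<bullet> b) * \<omega> t (of_coord M c (x t) b))"
    if "t \<in> S" for t
  proof -
    have l: "linear (\<lambda>a. \<omega> t (of_coord M c (x t) a))"
      using linear_compose[OF linear_of_coord lin] c that by (auto simp: o_def)
    have "\<omega> t (v t) = \<omega> t (of_coord M c (x t) (to_coord M c (x t) (v t)))"
      using c that by (simp add: of_coord_to_coord)
    also have "\<dots> = (\<Sum>b\<in>Basis. (to_coord M c (x t) (v t) \<bullet> b) *\<^sub>R \<omega> t (of_coord M c (x t) b))"
      by (subst euclidean_representation[symmetric]) (simp add: linear_sum[OF l] linear_scale[OF l])
    finally show ?thesis by simp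
  qed
  then show ?thesis
    by (subst continuous_on_cong[OF refl]) (auto intro!: continuous_intros v \<omega>)
qed

text \<open>Continuity is local, and the preimage of the preferred chart domain at
  \<open>x t\<close> is a relative neighbourhood of \<open>t\<close>.\<close>

lemma continuous_on_chartwise:
  fixes x :: "'t::topological_space \<Rightarrow> 'm"
  assumes x: "continuous_on S x"
    and h: "\<And>c. c \<in> charts M \<Longrightarrow> continuous_on {t \<in> S. x t \<in> chart_dom c} h"
  shows "continuous_on S h"
  unfolding continuous_on
proof
  fix t assume t: "t \<in> S"
  let ?c = "chart_at M (x t)"
  obtain A where A: "open A" "A \<inter> S = x -` chart_dom ?c \<inter> S"
    using x open_chart_dom[of ?c] unfolding continuous_on_open_invariant by auto
  have "at t within S = at t within {s \<in> S. x s \<in> chart_dom ?c}"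
    by (rule at_within_nhd[of _ A]) (use A t in auto)
  moreover have "t \<in> {s \<in> S. x s \<in> chart_dom ?c}"
    using t by simp
  ultimately show "(h \<longlongrightarrow> h t) (at t within S)"
    using h[of ?c] unfolding continuous_on by auto
qed

lemma continuous_on_pairing:
  fixes x :: "'t::topological_space \<Rightarrow> 'm"
  assumes "continuous_on S x" "\<And>t. t \<in> S \<Longrightarrow> linear (\<omega> t)"
    and "\<And>c. c \<in> charts M \<Longrightarrow> continuous_on {t \<in> S. x t \<in> chart_dom c} (\<lambda>t. to_coord M c (x t) (v t))"
    and "\<And>c a. c \<in> charts M \<Longrightarrow>
      continuous_on {t \<in> S. x t \<in> chart_dom c} (\<lambda>t. \<omega> t (of_coord M c (x t) a))"
  shows "continuous_on S (\<lambda>t. \<omega> t (v t) :: real)"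
  using assms(1)
proof (rule continuous_on_chartwise)
  fix c assume c: "c \<in> charts M"
  show "continuous_on {t \<in> S. x t \<in> chart_dom c} (\<lambda>t. \<omega> t (v t))"
    by (rule continuous_on_pairing_chart[OF c, where x = x]) (use c assms in auto)
qed

section \<open>The Riemannian metric and its norm\<close>

lemma
  shows bilinear_metric: "bilinear (metric M p)"
    and metric_sym: "metric M p a b = metric M p b a"
    and metric_pos: "a \<noteq> 0 \<Longrightarrow> metric M p a a > 0"
  using riemannian by (auto simp: riemannian_manifold_def)

text \<open>Two applications of the pairing lemma: the covector is first the metric with a constant
  coordinate vector in the second slot, then the metric with \<open>v\<close> in the first.\<close>

lemma continuous_on_metric:
  fixes v w :: "'m \<Rightarrow> 'e"
  assumes v: "\<And>c. c \<in> charts M \<Longrightarrow> continuous_on (S \<inter> chart_dom c) (\<lambda>p. to_coord M c p (v p))"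
    and w: "\<And>c. c \<in> charts M \<Longrightarrow> continuous_on (S \<inter> chart_dom c) (\<lambda>p. to_coord M c p (w p))"
  shows "continuous_on S (\<lambda>p. metric M p (v p) (w p))"
proof (rule continuous_on_chartwise[where x = "\<lambda>p. p"])
  fix c assume c: "c \<in> charts M"
  let ?S = "S \<inter> chart_dom c"
  have lin: "linear (\<lambda>b. metric M p b a)" "linear (metric M p a)" for p a
    using bilinear_metric[of p] by (auto simp: bilinear_def)
  have "continuous_on ?S (\<lambda>p. metric M p (of_coord M c p a) (of_coord M c p b))" for a b
  proof -
    have "continuous_on (chart_img c) (\<lambda>q. metric_coord M c q a b)"
      using riemannian c by (intro smooth_on_continuous) (simp add: riemannian_manifold_def)
    from continuous_on_compose2[OF this continuous_on_chart_map[OF c]]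
    have "continuous_on (chart_dom c) (\<lambda>p. metric_coord M c (chart_map c p) a b)" by auto
    then have "continuous_on ?S (\<lambda>p. metric_coord M c (chart_map c p) a b)"
      by (rule continuous_on_subset) auto
    then show ?thesis
      by (rule continuous_on_cong[THEN iffD1, rotated -1])
         (use c in \<open>auto simp: metric_coord_def chart_inv_chart_map\<close>)
  qed
  then have "continuous_on ?S (\<lambda>p. metric M p (v p) (of_coord M c p b))" for b
    using continuous_on_pairing_chart[OF c, of ?S "\<lambda>p. p" "\<lambda>p a. metric M p a (of_coord M c p b)" v]
      lin v[OF c] by simp
  then have "continuous_on ?S (\<lambda>p. metric M p (v p) (w p))"
    using continuous_on_pairing_chart[OF c, of ?S "\<lambda>p. p" "\<lambda>p. metric M p (v p)" w]
      lin w[OF c] by simp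
  then show "continuous_on {p \<in> S. p \<in> chart_dom c} (\<lambda>p. metric M p (v p) (w p))"
    by (simp add: Int_def)
qed (rule continuous_on_id)

lemma tnorm_nonneg: "tnorm M p a \<ge> 0"
  using metric_pos[of a p] bilinear_lzero[OF bilinear_metric, of p 0]
  by (cases "a = 0") (auto simp: tnorm_def)

lemma metric_self: "metric M p a a = (tnorm M p a)\<^sup>2"
  using metric_pos[of a p] bilinear_lzero[OF bilinear_metric, of p 0]
  by (cases "a = 0") (auto simp: tnorm_def)

lemma tnorm_pos: "a \<noteq> 0 \<Longrightarrow> tnorm M p a > 0"
  using metric_pos[of a p] by (simp add: tnorm_def)

lemma tnorm_scaleR: "tnorm M p (r *\<^sub>R a) = \<bar>r\<bar> * tnorm M p a"
  by (simp add: tnorm_def bilinear_lmul[OF bilinear_metric] bilinear_rmul[OF bilinear_metric]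
      real_sqrt_mult flip: mult.assoc)

text \<open>Cauchy-Schwarz inequality.\<close>

lemma metric_le_tnorm: "metric M p a b \<le> tnorm M p a * tnorm M p b"
proof (cases "b = 0")
  case True
  then show ?thesis
    using bilinear_rzero[OF bilinear_metric] tnorm_nonneg by simp
next
  case False
  let ?A = "metric M p a a" and ?B = "metric M p b b" and ?C = "metric M p a b"
  have B: "?B > 0" using metric_pos False by simp
  \<comment> \<open>The vector on the left is the part of \<open>a\<close> orthogonal to
    \<open>b\<close>; its square is nonnegative.\<close>
  have "metric M p (a - (?C / ?B) *\<^sub>R b) (a - (?C / ?B) *\<^sub>R b) = ?A - ?C\<^sup>2 / ?B"
    using B by (simp add: bilinear_lsub[OF bilinear_metric] bilinear_rsub[OF bilinear_metric]
        bilinear_lmul[OF bilinear_metric] bilinear_rmul[OF bilinear_metric] metric_sym[of p b a]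
        field_simps power2_eq_square)
  then have "?C\<^sup>2 / ?B \<le> ?A"
    by (metis metric_self zero_le_power2 diff_ge_0_iff_ge)
  then have "?C\<^sup>2 \<le> (tnorm M p a * tnorm M p b)\<^sup>2"
    using B by (simp add: divide_le_eq power_mult_distrib flip: metric_self)
  then show ?thesis
    using tnorm_nonneg by (meson mult_nonneg_nonneg power2_le_imp_le)
qed

lemma tnorm_triangle: "tnorm M p (a + b) \<le> tnorm M p a + tnorm M p b"
proof -
  have "(tnorm M p (a + b))\<^sup>2 \<le> (tnorm M p a + tnorm M p b)\<^sup>2"
    using metric_le_tnorm[of p a b] unfolding metric_self[symmetric] power2_sum
    by (simp add: bilinear_ladd[OF bilinear_metric] bilinear_radd[OF bilinear_metric]
        metric_sym[of p b a])
  then show ?thesis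
    using tnorm_nonneg by (meson add_nonneg_nonneg power2_le_imp_le)
qed

lemma tnorm_triangle_diff: "tnorm M p (a - b) \<le> tnorm M p a + tnorm M p b"
  using tnorm_triangle[of p a "- b"] tnorm_scaleR[of p "- 1" b] by simp

section \<open>Continuity of Hoelder fields\<close>

text \<open>The Hoelder bound is available only on compact subsets of the chart, so a compact piece
  of \<open>K\<close> containing all points of \<open>K\<close> near \<open>p\<close> has to be
  found.\<close>

lemma holder_in_charts_continuous_on:
  fixes h :: "('m, 'e) chart \<Rightarrow> 'm \<Rightarrow> 'b::real_normed_vector"
  assumes K: "compact K" and \<alpha>: "\<alpha> > 0" and h: "holder_in_charts M \<alpha> K h" and c: "c \<in> charts M"
  shows "continuous_on (K \<inter> chart_dom c) (h c)"
  unfolding continuous_on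
proof
  fix p assume p: "p \<in> K \<inter> chart_dom c"
  let ?at = "at p within (K \<inter> chart_dom c)"
  obtain r where r: "r > 0" "cball (chart_map c p) r \<subseteq> chart_img c"
    using open_chart_img[OF c] p by (meson IntD2 imageI open_contains_cball)
  \<comment> \<open>A closed coordinate ball inside the open chart image, carried back to the
    manifold, is compact and contains every point of the chart with coordinates within
    \<open>r\<close> of those of \<open>p\<close>.\<close>
  let ?L = "K \<inter> chart_inv c ` cball (chart_map c p) r"
  have "compact (chart_inv c ` cball (chart_map c p) r)"
    by (rule compact_continuous_image[OF continuous_on_subset[OF continuous_on_chart_inv[OF c] r(2)]])
      simp
  then have L: "compact ?L"
    using K by (intro closed_Int_compact compact_imp_closed)
  have "?L \<subseteq> K \<inter> chart_dom c"
    using r(2) chart_inv_in_dom[OF c] by auto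
  with h L c obtain C where
    C: "\<And>q q'. q \<in> ?L \<Longrightarrow> q' \<in> ?L \<Longrightarrow>
      norm (h c q - h c q') \<le> C * dist (chart_map c q) (chart_map c q') powr \<alpha>"
    unfolding holder_in_charts_def by meson
  have lim: "(chart_map c \<longlongrightarrow> chart_map c p) ?at"
    using continuous_on_subset[OF continuous_on_chart_map[OF c], of "K \<inter> chart_dom c"] p
    unfolding continuous_on by auto
  have inL: "q \<in> ?L" if "q \<in> K \<inter> chart_dom c" "dist (chart_map c q) (chart_map c p) < r" for q
    using that chart_inv_chart_map[OF c, of q]
    by (auto simp: dist_commute intro!: image_eqI[of _ _ "chart_map c q"])
  have pL: "p \<in> ?L"
    using inL[OF p] r by simp
  have "\<forall>\<^sub>F q in ?at. dist (chart_map c q) (chart_map c p) < r"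
    using lim r by (auto dest: tendstoD)
  moreover have "\<forall>\<^sub>F q in ?at. q \<in> K \<inter> chart_dom c"
    by (simp add: eventually_at_filter)
  ultimately have "\<forall>\<^sub>F q in ?at.
      norm (h c q - h c p) \<le> C * dist (chart_map c q) (chart_map c p) powr \<alpha>"
    by eventually_elim (use C pL inL in blast)
  moreover have "((\<lambda>q. C * dist (chart_map c q) (chart_map c p) powr \<alpha>) \<longlongrightarrow> C * 0) ?at"
    by (intro tendsto_mult tendsto_const tendsto_zero_powrI[where b = \<alpha>])
       (use \<alpha> lim in \<open>auto simp: tendsto_dist_iff[symmetric]\<close>)
  ultimately have "((\<lambda>q. h c q - h c p) \<longlongrightarrow> 0) ?at"
    by (auto intro: Lim_null_comparison)
  then show "(h c \<longlongrightarrow> h c p) ?at"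
    by (simp add: LIM_zero_iff)
qed

lemma holder_fun_continuous_on:
  assumes "compact K" "\<alpha> > 0" "\<eta> \<in> holder_fun M \<alpha> K"
  shows "continuous_on K \<eta>"
proof (rule continuous_on_chartwise[where x = "\<lambda>p. p"])
  fix c assume "c \<in> charts M"
  then show "continuous_on {p \<in> K. p \<in> chart_dom c} \<eta>"
    using holder_in_charts_continuous_on[of K \<alpha> "\<lambda>c. \<eta>" c] assms by (simp add: holder_fun_def Int_def)
qed (rule continuous_on_id)

lemma holder_vfields_continuous_on:
  assumes "compact K" "\<alpha> > 0" "v \<in> holder_vfields M \<alpha> K" "c \<in> charts M"
  shows "continuous_on (K \<inter> chart_dom c) (\<lambda>p. to_coord M c p (v p))"
  using holder_in_charts_continuous_on[of K \<alpha> _ c] assms by (auto simp: holder_vfields_def)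

lemma holder_pairing_continuous_on:
  assumes "compact K" "\<alpha> > 0" "v \<in> holder_vfields M \<alpha> K" "\<omega> \<in> holder_covfields M \<alpha> K"
  shows "continuous_on K (\<lambda>p. \<omega> p (v p))"
proof (rule continuous_on_pairing[where x = "\<lambda>p. p"])
  fix c a assume c: "c \<in> charts M"
  show "continuous_on {p \<in> K. p \<in> chart_dom c} (\<lambda>p. to_coord M c p (v p))"
    using holder_vfields_continuous_on[OF assms(1-3) c] by (simp add: Int_def)
  show "continuous_on {p \<in> K. p \<in> chart_dom c} (\<lambda>p. \<omega> p (of_coord M c p a))"
    using holder_in_charts_continuous_on[of K \<alpha> "\<lambda>c p. \<omega> p (of_coord M c p a)" c] assms c
    by (simp add: holder_covfields_def Int_def)
qed (use assms in \<open>auto simp: holder_covfields_def\<close>)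

lemma bounded_tnorm_on_compact:
  fixes v :: "'m \<Rightarrow> 'e"
  assumes "compact K"
    and "\<And>c. c \<in> charts M \<Longrightarrow> continuous_on (K \<inter> chart_dom c) (\<lambda>p. to_coord M c p (v p))"
  obtains B where "\<And>p. p \<in> K \<Longrightarrow> tnorm M p (v p) \<le> B"
proof -
  have "continuous_on K (\<lambda>p. tnorm M p (v p))"
    unfolding tnorm_def by (intro continuous_intros continuous_on_metric assms)
  from compact_imp_bounded[OF compact_continuous_image[OF this assms(1)]] that show ?thesis
    by (auto simp: bounded_iff) (meson abs_le_D1)
qed

end


section \<open>Pushforwards and Lie derivatives\<close>

text \<open>Exponential decay beats linear growth, so the upper bound tends to zero. This is what
  makes the stable and unstable components vanish later.\<close>

lemma le_zero_if_le_powr_times_linear: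
  fixes z \<theta> A B C :: real
  assumes \<theta>: "0 < \<theta>" "\<theta> < 1" and le: "\<And>t. t \<ge> 0 \<Longrightarrow> z \<le> C * \<theta> powr t * (A + B * t)"
  shows "z \<le> 0"
proof -
  define k where "k = - ln \<theta>"
  have k: "k > 0" using \<theta> by (simp add: k_def)
  have kt: "filterlim (\<lambda>t. k * t) at_top at_top"
    using k by (intro filterlim_tendsto_pos_mult_at_top[OF tendsto_const] filterlim_ident)
  have lim: "((\<lambda>t. (k * t) ^ n / exp (k * t)) \<longlongrightarrow> 0) at_top" for n
    by (rule filterlim_compose[OF tendsto_power_div_exp_0 kt])
  have "((\<lambda>t. exp (- k * t)) \<longlongrightarrow> 0) at_top"
    using lim[of 0] by (simp add: exp_minus inverse_eq_divide)
  moreover have "((\<lambda>t. t * exp (- k * t)) \<longlongrightarrow> 0) at_top"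
    using tendsto_mult[OF tendsto_const[of "1 / k"] lim[of 1]] k
    by (simp add: exp_minus inverse_eq_divide)
  ultimately have "((\<lambda>t. C * A * exp (- k * t) + C * B * (t * exp (- k * t))) \<longlongrightarrow> C * A * 0 + C * B * 0) at_top"
    by (intro tendsto_intros)
  moreover have "C * \<theta> powr t * (A + B * t) = C * A * exp (- k * t) + C * B * (t * exp (- k * t))" for t
    using \<theta> by (simp add: powr_def k_def algebra_simps)
  ultimately have "((\<lambda>t. C * \<theta> powr t * (A + B * t)) \<longlongrightarrow> 0) at_top"
    by simp
  then show ?thesis
    by (rule tendsto_lowerbound) (use le in \<open>auto intro: eventually_at_top_linorderI\<close>)
qed

lemma differentiable_transform_open:
  assumes "g differentiable (at x)" "open S" "x \<in> S" "\<And>y. y \<in> S \<Longrightarrow> h y = g y"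
  shows "h differentiable (at x)"
proof -
  obtain D where "(g has_derivative D) (at x)"
    using assms(1) by (auto simp: differentiable_def)
  then have "(h has_derivative D) (at x)"
    by (rule has_derivative_transform_within_open[OF _ assms(2,3)]) (simp add: assms(4))
  then show ?thesis by (rule differentiableI)
qed

lemma differentiable_shift:
  fixes h :: "real \<Rightarrow> 'a::real_normed_vector"
  assumes "h differentiable (at t)"
  shows "(\<lambda>s. h (t + s)) differentiable (at 0)"
  by (rule differentiable_compose[where f = h]) (use assms in \<open>auto intro!: derivative_intros\<close>)

locale mfd_flow = riemannian_mfd M
  for M :: "('m::{t2_space, second_countable_topology}, 'e::euclidean_space) riemannian" +
  fixes F :: "'m \<Rightarrow> 'e" and f :: "real \<Rightarrow> 'm \<Rightarrow> 'm"
  assumes smooth_F: "smooth_vector_field M F" and flow: "flow_of M F f"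
begin

section \<open>The flow in charts and its tangent maps\<close>

lemma flow_zero [simp]: "f 0 p = p"
  using flow by (simp add: flow_of_def)

lemma flow_add: "f (s + t) p = f s (f t p)"
  using flow by (simp add: flow_of_def)

lemma continuous_on_flow_curve: "continuous_on S (\<lambda>t. f t p)"
proof -
  have "continuous_on UNIV (\<lambda>(t, p). f t p)"
    using flow by (simp add: flow_of_def)
  then have "continuous_on S (\<lambda>t. case (t, p) of (t, p) \<Rightarrow> f t p)"
    by (rule continuous_on_compose2) (auto intro!: continuous_intros)
  then show ?thesis by simp
qed

lemma continuous_on_flow_map: "continuous_on S (f t)"
proof -
  have "continuous_on UNIV (\<lambda>(t, p). f t p)"
    using flow by (simp add: flow_of_def)
  then have "continuous_on S (\<lambda>p. case (t, p) of (t, p) \<Rightarrow> f t p)"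
    by (rule continuous_on_compose2) (auto intro!: continuous_intros)
  then show ?thesis by simp
qed

text \<open>Time and position are kept as joint variables, since a pullback along an orbit varies
  both at once.\<close>

definition flow_coord :: "('m, 'e) chart \<Rightarrow> ('m, 'e) chart \<Rightarrow> real \<times> 'e \<Rightarrow> 'e" where
  "flow_coord c d = (\<lambda>(t, q). chart_map d (f t (chart_inv c q)))"

text \<open>Two orders of smoothness are needed: the pushforward is a first derivative of the flow,
  and the Lie derivative differentiates it once more along the orbit.\<close>

lemma
  assumes "c \<in> charts M" "p \<in> chart_dom c" "d \<in> charts M" "f t p \<in> chart_dom d"
  shows flow_coord_differentiable:
      "flow_coord c d differentiable (at (t, chart_map c p))"
    and flow_coord_derivative_differentiable:
      "(\<lambda>z. frechet_derivative (flow_coord c d) (at z) a) differentiable (at (t, chart_map c p))"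
proof -
  let ?S = "{(t, q). q \<in> chart_img c \<and> f t (chart_inv c q) \<in> chart_dom d}"
  have "smooth_on ?S (flow_coord c d)"
    using flow assms by (simp add: flow_of_def flow_coord_def)
  moreover have "(t, chart_map c p) \<in> ?S"
    using assms by (simp add: chart_inv_chart_map)
  ultimately show "flow_coord c d differentiable (at (t, chart_map c p))"
    "(\<lambda>z. frechet_derivative (flow_coord c d) (at z) a) differentiable (at (t, chart_map c p))"
    by (auto intro: smooth_on_differentiable smooth_on_frechet_derivative_differentiable)
qed

text \<open>The chain rule through \<open>q \<mapsto> (t, q)\<close> exhibits the tangent map as the
  spatial part of the joint derivative, whose base time and base point can be varied
  differentiably.\<close>

lemma flow_tangent_map:
  assumes "c \<in> charts M" "p \<in> chart_dom c" "d \<in> charts M" "f t p \<in> chart_dom d"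
  shows "chart_differentiable c d (f t) p"
    and "tangent_map c d (f t) p b =
           frechet_derivative (flow_coord c d) (at (t, chart_map c p)) (0, b)"
proof -
  have "((\<lambda>q. (t, q)) has_derivative (\<lambda>b. (0, b))) (at (chart_map c p))"
    by (auto intro!: derivative_eq_intros)
  moreover have "(flow_coord c d has_derivative
      frechet_derivative (flow_coord c d) (at (t, chart_map c p))) (at (t, chart_map c p))"
    using flow_coord_differentiable[OF assms] frechet_derivative_works by blast
  ultimately have "(flow_coord c d \<circ> (\<lambda>q. (t, q)) has_derivative
      frechet_derivative (flow_coord c d) (at (t, chart_map c p)) \<circ> (\<lambda>b. (0, b)))
      (at (chart_map c p))"
    by (rule diff_chain_at)
  moreover have "flow_coord c d \<circ> (\<lambda>q. (t, q)) = chart_map d \<circ> f t \<circ> chart_inv c"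
    by (auto simp: flow_coord_def)
  ultimately have *: "(chart_map d \<circ> f t \<circ> chart_inv c has_derivative
      frechet_derivative (flow_coord c d) (at (t, chart_map c p)) \<circ> (\<lambda>b. (0, b)))
      (at (chart_map c p))"
    by simp
  then show "chart_differentiable c d (f t) p"
    unfolding chart_differentiable_def by (rule differentiableI)
  show "tangent_map c d (f t) p b =
      frechet_derivative (flow_coord c d) (at (t, chart_map c p)) (0, b)"
    unfolding tangent_map_def frechet_derivative_at[OF *, symmetric] by simp
qed

lemma linear_pushforward: "linear (pushforward M f t p)"
  unfolding pushforward_eq by (intro linear_tangent_map flow_tangent_map) auto

lemma pushforward_zero: "pushforward M f 0 p a = a"
proof -
  have "f 0 = id" by auto
  then show ?thesis
    by (simp add: pushforward_eq tangent_map_id)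
qed

text \<open>The chain rule applied to the group law of the flow.\<close>

lemma pushforward_add:
  "pushforward M f (s + t) p a = pushforward M f s (f t p) (pushforward M f t p a)"
proof -
  have "f (s + t) = f s \<circ> f t" by (auto simp: flow_add)
  moreover have "tangent_map (chart_at M p) (chart_at M (f s (f t p))) (f s \<circ> f t) p =
    tangent_map (chart_at M (f t p)) (chart_at M (f s (f t p))) (f s) (f t p) \<circ>
    tangent_map (chart_at M p) (chart_at M (f t p)) (f t) p"
    by (rule tangent_map_compose) (auto intro!: flow_tangent_map continuous_on_flow_map)
  ultimately show ?thesis
    by (simp add: pushforward_eq)
qed

lemma flow_inverse [simp]: "f (- t) (f t p) = p" "f t (f (- t) p) = p"
  using flow_add[of "- t" t p] flow_add[of t "- t" p] by simp_all

lemma pushforward_inverse [simp]: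
  "pushforward M f (- t) (f t p) (pushforward M f t p a) = a"
  "pushforward M f t (f (- t) p) (pushforward M f (- t) p a) = a"
  using pushforward_add[of "- t" t p a] pushforward_add[of t "- t" p a]
  by (simp_all add: pushforward_zero)

lemma flow_curve_derivative:
  "((\<lambda>s. chart_map (chart_at M p) (f s p)) has_vector_derivative F p) (at 0)"
  using flow by (simp add: flow_of_def)

lemma open_flow_curve_preimage: "open A \<Longrightarrow> open {s. f s p \<in> A}"
  using continuous_on_flow_curve[of UNIV p] by (simp add: continuous_on_open_vimage vimage_def)

text \<open>Since \<open>f\<^sup>t\<close> commutes with \<open>f\<^sup>s\<close>, it carries the
  orbit curve through \<open>p\<close> to the one through \<open>f t p\<close> with unchanged
  parametrization; both sides are the velocity of the latter curve at time 0.\<close>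

lemma pushforward_F: "pushforward M f t p (F p) = F (f t p)"
proof -
  let ?c = "chart_at M p" and ?d = "chart_at M (f t p)"
  let ?g = "chart_map ?d \<circ> f t \<circ> chart_inv ?c"
  have "(?g has_derivative pushforward M f t p) (at (chart_map ?c p))"
    using flow_tangent_map(1)[of ?c p ?d t] frechet_derivative_works[of ?g]
    by (simp add: chart_differentiable_def pushforward_def)
  then have "(?g has_derivative pushforward M f t p) (at (chart_map ?c (f 0 p)))"
    by simp
  from diff_chain_at[OF flow_curve_derivative[unfolded has_vector_derivative_def] this]
  have "((\<lambda>s. ?g (chart_map ?c (f s p))) has_vector_derivative pushforward M f t p (F p)) (at 0)"
    by (simp add: has_vector_derivative_def o_def linear_scale[OF linear_pushforward])
  then have "((\<lambda>s. chart_map ?d (f s (f t p))) has_vector_derivative pushforward M f t p (F p)) (at 0)"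
    by (rule has_vector_derivative_transform_within_open[
          OF _ open_flow_curve_preimage[OF open_chart_dom[of ?c], of p]])
       (auto simp: chart_inv_chart_map add.commute simp flip: flow_add)
  with flow_curve_derivative[of "f t p"] show ?thesis
    by (metis vector_derivative_at)
qed

section \<open>Derivatives of pullbacks along an orbit\<close>

text \<open>In the chart at \<open>p\<close> the pullback is a finite sum of coordinates of
  \<open>v\<close> times images of basis vectors, and both factors are differentiable at 0. As
  \<open>f (- s)\<close> sends \<open>f s p\<close> back to \<open>p\<close>, this one chart serves
  at both ends.\<close>

lemma pullback_differentiable:
  assumes v: "(\<lambda>s. to_coord M (chart_at M p) (f s p) (v s)) differentiable (at 0)"
  shows "(\<lambda>s. pushforward M f (- s) (f s p) (v s)) differentiable (at 0)"
proof -
  let ?c = "chart_at M p"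
  let ?u = "\<lambda>s. to_coord M ?c (f s p) (v s)"
  let ?S = "{s. f s p \<in> chart_dom ?c}"
  \<comment> \<open>For small \<open>s\<close>, the image of \<open>b\<close> under the tangent map
    of \<open>f (- s)\<close> at the moving point \<open>f s p\<close>.\<close>
  let ?D = "\<lambda>b s. frechet_derivative (flow_coord ?c ?c) (at (- s, chart_map ?c (f s p))) (0, b)"
  have D: "?D b differentiable (at 0)" for b
  proof (rule differentiable_compose[where f = "\<lambda>z. frechet_derivative (flow_coord ?c ?c) (at z) (0, b)"
        and g = "\<lambda>s. (- s, chart_map ?c (f s p))"])
    show "(\<lambda>z. frechet_derivative (flow_coord ?c ?c) (at z) (0, b)) differentiable
        (at (- 0, chart_map ?c (f 0 p)))"
      using flow_coord_derivative_differentiable[of ?c p ?c 0] by simp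
    have "((\<lambda>s. (- s, chart_map ?c (f s p))) has_derivative (\<lambda>s. (- s, s *\<^sub>R F p))) (at 0)"
      using flow_curve_derivative[of p] unfolding has_vector_derivative_def
      by (intro has_derivative_Pair has_derivative_minus has_derivative_ident)
    then show "(\<lambda>s. (- s, chart_map ?c (f s p))) differentiable (at 0)"
      by (rule differentiableI)
  qed
  have "(\<lambda>s. \<Sum>b\<in>Basis. (?u s \<bullet> b) *\<^sub>R ?D b s) differentiable (at 0)"
    by (intro differentiable_sum finite_Basis ballI)
       (rule differentiable_scaleR[OF differentiable_inner[OF v differentiable_const] D])
  moreover have pushforward_eq_sum: "pushforward M f (- s) (f s p) (v s) = (\<Sum>b\<in>Basis. (?u s \<bullet> b) *\<^sub>R ?D b s)"
    if s: "s \<in> ?S" for s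
  proof -
    let ?q = "f s p"
    have "tangent_map (chart_at M ?q) ?c (f (- s) \<circ> id) ?q =
        tangent_map ?c ?c (f (- s)) (id ?q) \<circ> tangent_map (chart_at M ?q) ?c id ?q"
      by (rule tangent_map_compose)
         (use s in \<open>auto intro!: flow_tangent_map chart_differentiable_id continuous_on_id\<close>)
    then have "pushforward M f (- s) ?q (v s) = tangent_map ?c ?c (f (- s)) ?q (?u s)"
      by (simp add: pushforward_eq to_coord_eq)
    also have "\<dots> = (\<Sum>b\<in>Basis. (?u s \<bullet> b) *\<^sub>R tangent_map ?c ?c (f (- s)) ?q b)"
    proof -
      have l: "linear (tangent_map ?c ?c (f (- s)) ?q)"
        using s by (intro linear_tangent_map flow_tangent_map) auto
      show ?thesis
        by (subst euclidean_representation[of "?u s", symmetric])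
           (simp only: linear_sum[OF l] linear_scale[OF l])
    qed
    also have "\<dots> = (\<Sum>b\<in>Basis. (?u s \<bullet> b) *\<^sub>R ?D b s)"
      using s by (simp add: flow_tangent_map(2))
    finally show ?thesis .
  qed
  moreover have "open ?S"
    by (intro open_flow_curve_preimage open_chart_dom) simp
  ultimately show ?thesis
    by - (rule differentiable_transform_open[OF _ _ _ pushforward_eq_sum], auto)
qed

text \<open>Pulling back by \<open>t + s\<close> to \<open>p\<close> is pulling back by
  \<open>s\<close> to \<open>f t p\<close> and then applying a linear map independent of
  \<open>s\<close>, so the derivative at \<open>s = 0\<close> passes through this map.\<close>

lemma pullback_has_vector_derivative:
  assumes "(\<lambda>s. to_coord M (chart_at M (f t p)) (f (t + s) p) (v (t + s))) differentiable (at 0)"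
  shows "((\<lambda>s. pushforward M f (- s) (f s p) (v s)) has_vector_derivative
           pushforward M f (- t) (f t p) (lie_orbit M f (\<lambda>t. f t p) v t)) (at t)"
proof -
  let ?W = "\<lambda>s. pushforward M f (- s) (f s p) (v s)"
  let ?H = "\<lambda>s. pushforward M f (- s) (f (t + s) p) (v (t + s))"
  have add: "f s (f t p) = f (t + s) p" for s
    by (simp add: add.commute flip: flow_add)
  have "?H differentiable (at 0)"
    using pullback_differentiable[of "f t p" "\<lambda>s. v (t + s)"] assms by (simp add: add)
  then have H: "(?H has_vector_derivative lie_orbit M f (\<lambda>t. f t p) v t) (at 0)"
    by (simp add: lie_orbit_def vector_derivative_works)
  have "?W (t + s) = pushforward M f (- t) (f t p) (?H s)" for s
    using pushforward_add[of "- t" "- s" "f (t + s) p" "v (t + s)"] flow_add[of "- s" "t + s" p]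
    by simp
  then have "((\<lambda>s. ?W (t + s)) has_vector_derivative
      pushforward M f (- t) (f t p) (lie_orbit M f (\<lambda>t. f t p) v t)) (at 0)"
    using bounded_linear.has_vector_derivative[OF
        linear_pushforward[unfolded linear_conv_bounded_linear] H] by simp
  \<comment> \<open>Zero is written as \<open>t - t\<close> to match the chain rule with inner
    function \<open>s - t\<close>.\<close>
  then have 1: "((\<lambda>s. ?W (t + s)) has_vector_derivative
      pushforward M f (- t) (f t p) (lie_orbit M f (\<lambda>t. f t p) v t)) (at (t - t))"
    by simp
  have "((\<lambda>s. s - t) has_vector_derivative 1) (at t)"
    by (auto intro!: derivative_eq_intros)
  from vector_diff_chain_at[OF this 1] show ?thesis
    by (simp add: o_def)
qed

lemma continuous_on_F:
  assumes "c \<in> charts M"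
  shows "continuous_on (S \<inter> chart_dom c) (\<lambda>p. to_coord M c p (F p))"
proof -
  have "continuous_on (chart_img c) (\<lambda>q. to_coord M c (chart_inv c q) (F (chart_inv c q)))"
    using smooth_F assms by (simp add: smooth_vector_field_def smooth_on_continuous)
  from continuous_on_compose2[OF this continuous_on_chart_map[OF assms]]
  have "continuous_on (chart_dom c) (\<lambda>p. to_coord M c p (F p))"
    using assms by (auto simp: chart_inv_chart_map cong: continuous_on_cong)
  then show ?thesis
    by (rule continuous_on_subset) auto
qed

text \<open>This lets a field on \<open>K\<close> be treated as a field along each orbit.\<close>

lemma lie_along_eq_lie_orbit:
  "lie_along M f v (f t p) = lie_orbit M f (\<lambda>t. f t p) (\<lambda>t. v (f t p)) t"
  by (simp add: lie_along_def lie_orbit_def add.commute flip: flow_add)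


section \<open>Equivalent pairs differ by a multiple of \<open>F\<close>\<close>

text \<open>Compactness keeps \<open>F\<close> away from zero on \<open>K\<close>; this later turns
  a bound for \<open>\<phi> F\<close> into one for \<phi>.\<close>

lemma inverse_tnorm_F_bounded:
  assumes "compact K" "\<forall>p\<in>K. F p \<noteq> 0"
  obtains B where "\<And>p. p \<in> K \<Longrightarrow> inverse (tnorm M p (F p)) \<le> B"
proof -
  have "continuous_on K (\<lambda>p. inverse (tnorm M p (F p)))"
  proof (rule continuous_on_inverse)
    show "continuous_on K (\<lambda>p. tnorm M p (F p))"
      unfolding tnorm_def by (intro continuous_intros continuous_on_metric continuous_on_F)
    show "\<forall>p\<in>K. tnorm M p (F p) \<noteq> 0"
      using assms(2) tnorm_pos by (metis less_irrefl)
  qed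
  from compact_imp_bounded[OF compact_continuous_image[OF this assms(1)]]
  obtain B where "\<forall>p\<in>K. norm (inverse (tnorm M p (F p))) \<le> B"
    by (auto simp: bounded_iff)
  then show ?thesis
    using that by (metis norm_ge_zero abs_le_D1 real_norm_def)
qed

lemma
  assumes "hyperbolic_attractor M F f K U"
  shows attractor_compact: "compact K" and attractor_F_nonzero: "\<forall>p\<in>K. F p \<noteq> 0"
    and attractor_invariant: "p \<in> K \<Longrightarrow> f t p \<in> K"
proof -
  have "f t ` K = K"
    using assms by (simp add: hyperbolic_attractor_def)
  then show "p \<in> K \<Longrightarrow> f t p \<in> K" by blast
qed (use assms in \<open>simp_all add: hyperbolic_attractor_def\<close>)

text \<open>Hypothesis \<open>W\<close> is the equation \<open>\<L>\<^sub>F w = - \<xi> F\<close>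
  transported to the fixed tangent space at \<open>p\<close>, where it can be integrated.\<close>

lemma lie_proportional_imp_proportional:
  assumes K: "hyperbolic_attractor M F f K U" "p \<in> K"
    and bounded: "\<And>t. tnorm M (f t p) (w t) \<le> B" "\<And>t. \<bar>\<xi> t\<bar> \<le> C"
    and W: "\<And>t. ((\<lambda>s. pushforward M f (- s) (f s p) (w s)) has_vector_derivative
                  - \<xi> t *\<^sub>R F p) (at t)"
  obtains \<phi> where "\<And>t. w t = \<phi> t *\<^sub>R F (f t p)"
    and "\<And>t. (\<phi> has_real_derivative - \<xi> t) (at t)"
proof -
  let ?P = "pushforward M f"
  let ?W = "\<lambda>s. ?P (- s) (f s p) (w s)"
  have "F p \<noteq> 0" and orbit: "f t p \<in> K" for t
    using K attractor_F_nonzero attractor_invariant by blast+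
  \<comment> \<open>A fixed linear functional with value 1 on \<open>F p\<close> extracts a
    coefficient of \<open>F p\<close>. The Euclidean inner product of the model space will do,
    because the base point does not move.\<close>
  define \<phi>0 where "\<phi>0 t = (?W t \<bullet> F p) / (F p \<bullet> F p)" for t
  have \<phi>0': "(\<phi>0 has_vector_derivative - \<xi> t) (at t)" for t
  proof -
    have "bounded_linear (\<lambda>a. (a \<bullet> F p) / (F p \<bullet> F p))"
      by (rule bounded_linear_compose[OF bounded_linear_divide bounded_linear_inner_left])
    from bounded_linear.has_vector_derivative[OF this W[of t]] show ?thesis
      using \<open>F p \<noteq> 0\<close> by (simp add: \<phi>0_def[abs_def])
  qed
  \<comment> \<open>The pullback varies only along \<open>F p\<close>, at exactly the rate of
    \<open>\<phi>0\<close>, so the remainder is constant. Hyperbolicity is applied to this one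
    vector \<open>z\<close>.\<close>
  have "\<exists>z. \<forall>t. ?W t - \<phi>0 t *\<^sub>R F p = z"
  proof (rule has_vector_derivative_zero_constant[of UNIV "\<lambda>t. ?W t - \<phi>0 t *\<^sub>R F p"])
    fix t :: real
    have "((\<lambda>s. ?W s - \<phi>0 s *\<^sub>R F p) has_vector_derivative
        - \<xi> t *\<^sub>R F p - (\<phi>0 t *\<^sub>R 0 + (- \<xi> t) *\<^sub>R F p)) (at t)"
      using \<phi>0' by (intro has_vector_derivative_diff has_vector_derivative_scaleR W
          has_vector_derivative_const) (simp add: has_real_derivative_iff_has_vector_derivative)
    then show "((\<lambda>s. ?W s - \<phi>0 s *\<^sub>R F p) has_vector_derivative 0) (at t within UNIV)"
      by simp
  qed auto
  then obtain z where z: "\<And>t. ?W t = z + \<phi>0 t *\<^sub>R F p"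
    by (metis diff_add_cancel)
  obtain Vs Vu where split: "hyperbolic_splitting M F f K Vs Vu"
    using K unfolding hyperbolic_attractor_def by blast
  from split have
    "\<forall>p\<in>K. \<forall>w. \<exists>!(a, b, y). a \<in> Vs p \<and> b \<in> Vu p \<and> y \<in> span {F p} \<and> w = a + b + y"
    and maps: "\<forall>p\<in>K. \<forall>t. ?P t p ` Vs p = Vs (f t p) \<and> ?P t p ` Vu p = Vu (f t p)"
    and rates: "\<exists>C>0. \<exists>\<theta>>0. \<theta> < 1 \<and> (\<forall>p\<in>K. \<forall>t\<ge>0.
        (\<forall>a\<in>Vs p. tnorm M (f t p) (?P t p a) \<le> C * \<theta> powr t * tnorm M p a) \<and>
        (\<forall>b\<in>Vu p. tnorm M (f (- t) p) (?P (- t) p b) \<le> C * \<theta> powr t * tnorm M p b))"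
    unfolding hyperbolic_splitting_def by simp_all
  from spec[OF bspec[OF this(1) K(2)], of z, THEN ex1_implies_ex]
  obtain a b y where ab: "a \<in> Vs p" "b \<in> Vu p" and y: "y \<in> span {F p}" "z = a + b + y"
    by auto
  then obtain k where z_eq: "z = a + b + k *\<^sub>R F p"
    unfolding span_singleton by auto
  \<comment> \<open>The part of \<open>z\<close> along \<open>F p\<close> is merged with
    \<open>\<phi>0\<close>, leaving only a stable and an unstable vector.\<close>
  define \<phi> where "\<phi> t = k + \<phi>0 t" for t
  have \<phi>': "(\<phi> has_real_derivative - \<xi> t) (at t)" for t
    using \<phi>0'[of t] unfolding \<phi>_def[abs_def] has_real_derivative_iff_has_vector_derivative[symmetric]
    by (auto intro!: derivative_eq_intros)
  have w: "w t = ?P t p a + ?P t p b + \<phi> t *\<^sub>R F (f t p)" for t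
  proof -
    have "w t = ?P t p (?W t)"
      using pushforward_inverse(2)[of t "f t p" "w t"] by simp
    then show ?thesis
      by (simp add: z z_eq \<phi>_def linear_add[OF linear_pushforward]
          linear_scale[OF linear_pushforward] pushforward_F scaleR_add_left)
  qed
  obtain BF where BF: "\<And>p. p \<in> K \<Longrightarrow> tnorm M p (F p) \<le> BF"
    using bounded_tnorm_on_compact[OF attractor_compact[OF K(1)] continuous_on_F] by blast
  \<comment> \<open>The derivative of \<phi> is \<open>- \<xi>\<close>, so \<phi> is Lipschitz with
    constant \<open>C\<close>, and the sum of the transported vectors \<open>a\<close> and
    \<open>b\<close> grows at most linearly in \<open>\<bar>t\<bar>\<close>.\<close>
  have lin: "tnorm M (f t p) (w t - \<phi> t *\<^sub>R F (f t p)) \<le> B + (\<bar>\<phi> 0\<bar> + C * \<bar>t\<bar>) * BF" for t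
  proof -
    have "norm (\<phi> t - \<phi> 0) \<le> C * norm (t - 0)"
      by (rule field_differentiable_bound[of UNIV]) (use \<phi>' bounded in auto)
    then have "\<bar>\<phi> t\<bar> \<le> \<bar>\<phi> 0\<bar> + C * \<bar>t\<bar>"
      by simp
    then have "\<bar>\<phi> t\<bar> * tnorm M (f t p) (F (f t p)) \<le> (\<bar>\<phi> 0\<bar> + C * \<bar>t\<bar>) * BF"
      using BF[OF orbit] tnorm_nonneg by (intro mult_mono) (auto intro: order_trans)
    then show ?thesis
      using tnorm_triangle_diff[of "f t p" "w t" "\<phi> t *\<^sub>R F (f t p)"] bounded(1)[of t]
      by (simp add: tnorm_scaleR)
  qed
  obtain D \<theta> where D: "D > 0" and \<theta>: "0 < \<theta>" "\<theta> < 1"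
    and stable: "\<And>q t a. q \<in> K \<Longrightarrow> t \<ge> 0 \<Longrightarrow> a \<in> Vs q \<Longrightarrow>
      tnorm M (f t q) (?P t q a) \<le> D * \<theta> powr t * tnorm M q a"
    and unstable: "\<And>q t a. q \<in> K \<Longrightarrow> t \<ge> 0 \<Longrightarrow> a \<in> Vu q \<Longrightarrow>
      tnorm M (f (- t) q) (?P (- t) q a) \<le> D * \<theta> powr t * tnorm M q a"
    using rates by blast
  have invariant: "?P t p a \<in> Vs (f t p)" "?P t p b \<in> Vu (f t p)" for t
    using maps K(2) ab by blast+
  have powr_le: "D * \<theta> powr t * r \<le> D * r" if "t \<ge> 0" "r \<ge> 0" for t r
    using that \<theta> D by (intro mult_right_mono) (auto simp: powr_le1)
  have vanish: "e = 0" if "\<And>t. t \<ge> 0 \<Longrightarrow> tnorm M p e \<le> D * \<theta> powr t * (A + C * BF * t)" for e A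
    using le_zero_if_le_powr_times_linear[OF \<theta> that] tnorm_pos[of e p] by (meson not_less)
  \<comment> \<open>For \<open>t \<ge> 0\<close> the stable part stays below
    \<open>D * tnorm M p a\<close>, so the unstable part inherits the linear bound; \<open>A\<close>
    collects the terms constant in \<open>t\<close>.\<close>
  have "b = 0"
  proof (rule vanish[where A = "B + \<bar>\<phi> 0\<bar> * BF + D * tnorm M p a"])
    fix t :: real assume t: "t \<ge> 0"
    let ?q = "f t p"
    have "?P t p b = (w t - \<phi> t *\<^sub>R F ?q) - ?P t p a"
      by (simp add: w)
    then have "tnorm M ?q (?P t p b) \<le> tnorm M ?q (w t - \<phi> t *\<^sub>R F ?q) + tnorm M ?q (?P t p a)"
      using tnorm_triangle_diff by metis
    also have "\<dots> \<le> (B + (\<bar>\<phi> 0\<bar> + C * t) * BF) + D * tnorm M p a"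
      using lin[of "t"] stable[OF K(2) t ab(1)] powr_le[OF t tnorm_nonneg, of p a] t by simp
    finally have "D * \<theta> powr t * tnorm M ?q (?P t p b) \<le>
        D * \<theta> powr t * (B + \<bar>\<phi> 0\<bar> * BF + D * tnorm M p a + C * BF * t)"
      using D by (intro mult_left_mono) (auto simp: algebra_simps)
    \<comment> \<open>Flowing back from \<open>f t p\<close> recovers \<open>b\<close> and contracts
      unstable vectors.\<close>
    moreover have "tnorm M p b \<le> D * \<theta> powr t * tnorm M ?q (?P t p b)"
      using unstable[OF orbit t invariant(2), of "t"] by simp
    ultimately show "tnorm M p b \<le>
        D * \<theta> powr t * (B + \<bar>\<phi> 0\<bar> * BF + D * tnorm M p a + C * BF * t)"
      by simp
  qed
  \<comment> \<open>The same with time reversed: going backwards the unstable part is bounded, and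
    flowing forward from \<open>f (- t) p\<close> contracts stable vectors.\<close>
  moreover have "a = 0"
  proof (rule vanish[where A = "B + \<bar>\<phi> 0\<bar> * BF + D * tnorm M p b"])
    fix t :: real assume t: "t \<ge> 0"
    let ?q = "f (- t) p"
    have "?P (- t) p a = (w (- t) - \<phi> (- t) *\<^sub>R F ?q) - ?P (- t) p b"
      by (simp add: w)
    then have "tnorm M ?q (?P (- t) p a) \<le> tnorm M ?q (w (- t) - \<phi> (- t) *\<^sub>R F ?q) + tnorm M ?q (?P (- t) p b)"
      using tnorm_triangle_diff by metis
    also have "\<dots> \<le> (B + (\<bar>\<phi> 0\<bar> + C * t) * BF) + D * tnorm M p b"
      using lin[of "- t"] unstable[OF K(2) t ab(2)] powr_le[OF t tnorm_nonneg, of p b] t by simp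
    finally have "D * \<theta> powr t * tnorm M ?q (?P (- t) p a) \<le>
        D * \<theta> powr t * (B + \<bar>\<phi> 0\<bar> * BF + D * tnorm M p b + C * BF * t)"
      using D by (intro mult_left_mono) (auto simp: algebra_simps)
    moreover have "tnorm M p a \<le> D * \<theta> powr t * tnorm M ?q (?P (- t) p a)"
      using stable[OF orbit t invariant(1), of "- t"] by simp
    ultimately show "tnorm M p a \<le>
        D * \<theta> powr t * (B + \<bar>\<phi> 0\<bar> * BF + D * tnorm M p b + C * BF * t)"
      by simp
  qed
  ultimately have "w t = \<phi> t *\<^sub>R F (f t p)" for t
    using w[of t] by (simp add: linear_0[OF linear_pushforward])
  then show thesis
    using \<phi>' by (rule that)
qed

text \<open>The preceding lemma applied to \<open>v1 - v2\<close> and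
  \<open>\<eta>1 - \<eta>2\<close>: the Lie derivatives differ by a multiple of \<open>F\<close>,
  and the pullback keeps the factor because the flow preserves \<open>F\<close>.\<close>

lemma equivalent_pairs_differ_by_F:
  assumes K: "hyperbolic_attractor M F f K U" "p \<in> K"
    and v1: "\<And>t. tnorm M (f t p) (v1 t) \<le> B1"
      "\<And>t. (\<lambda>s. to_coord M (chart_at M (f t p)) (f (t + s) p) (v1 (t + s))) differentiable (at 0)"
    and v2: "\<And>t. tnorm M (f t p) (v2 t) \<le> B2"
      "\<And>t. (\<lambda>s. to_coord M (chart_at M (f t p)) (f (t + s) p) (v2 (t + s))) differentiable (at 0)"
    and \<eta>: "\<And>t. \<bar>\<eta>1 t\<bar> \<le> C1" "\<And>t. \<bar>\<eta>2 t\<bar> \<le> C2"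
    and eq: "\<And>t. lie_orbit M f (\<lambda>t. f t p) v1 t + \<eta>1 t *\<^sub>R F (f t p) =
                  lie_orbit M f (\<lambda>t. f t p) v2 t + \<eta>2 t *\<^sub>R F (f t p)"
  obtains \<phi> where "\<And>t. v1 t - v2 t = \<phi> t *\<^sub>R F (f t p)"
    and "\<And>t. (\<phi> has_real_derivative \<eta>2 t - \<eta>1 t) (at t)"
proof -
  let ?L = "lie_orbit M f (\<lambda>t. f t p)"
  have "((\<lambda>s. pushforward M f (- s) (f s p) (v1 s - v2 s)) has_vector_derivative
      - (\<eta>1 t - \<eta>2 t) *\<^sub>R F p) (at t)" for t
  proof -
    have "pushforward M f (- t) (f t p) (?L v1 t) - pushforward M f (- t) (f t p) (?L v2 t) =
        pushforward M f (- t) (f t p) (- (\<eta>1 t - \<eta>2 t) *\<^sub>R F (f t p))"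
      unfolding linear_diff[OF linear_pushforward, symmetric]
      using eq[of t] by (intro arg_cong[of _ _ "pushforward M f (- t) (f t p)"]) (simp add: algebra_simps)
    also have "\<dots> = - (\<eta>1 t - \<eta>2 t) *\<^sub>R F p"
      using pushforward_F[of "- t" "f t p"] by (simp only: linear_scale[OF linear_pushforward]) simp
    finally show ?thesis
      using has_vector_derivative_diff[OF pullback_has_vector_derivative[OF v1(2)[of t]]
          pullback_has_vector_derivative[OF v2(2)[of t]]]
      by (simp add: linear_diff[OF linear_pushforward])
  qed
  moreover have "tnorm M (f t p) (v1 t - v2 t) \<le> B1 + B2" for t
    using tnorm_triangle_diff[of "f t p" "v1 t" "v2 t"] v1(1)[of t] v2(1)[of t] by simp
  moreover have "\<bar>\<eta>1 t - \<eta>2 t\<bar> \<le> C1 + C2" for t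
    using \<eta>[of t] by simp
  ultimately obtain \<phi> where "\<And>t. v1 t - v2 t = \<phi> t *\<^sub>R F (f t p)"
    "\<And>t. (\<phi> has_real_derivative - (\<eta>1 t - \<eta>2 t)) (at t)"
    using lie_proportional_imp_proportional[OF K, of "\<lambda>t. v1 t - v2 t" "B1 + B2" "\<lambda>t. \<eta>1 t - \<eta>2 t"
        "C1 + C2"] by blast
  then show thesis
    by (intro that[of \<phi>]) simp_all
qed


end


section \<open>The product on an orbit\<close>

text \<open>The integrals over \<open>{- T..T}\<close> differ by \<open>g T - g (- T)\<close>, at
  most \<open>2 * B\<close> in absolute value, so the averages differ by at most
  \<open>B / T\<close>.\<close>

lemma product_orbit_eq_if_difference_exact:
  assumes integrable: "continuous_on UNIV (\<lambda>t. \<omega> t (v1 t) - \<eta>1 t * \<psi> t)"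
      "continuous_on UNIV (\<lambda>t. \<omega> t (v2 t) - \<eta>2 t * \<psi> t)"
    and g: "\<And>t. (g has_real_derivative
              (\<omega> t (v1 t) - \<eta>1 t * \<psi> t) - (\<omega> t (v2 t) - \<eta>2 t * \<psi> t)) (at t)"
    and bounded: "\<And>t. \<bar>g t\<bar> \<le> B"
  shows "product_orbit v1 \<eta>1 \<omega> \<psi> = product_orbit v2 \<eta>2 \<omega> \<psi>"
proof -
  let ?h1 = "\<lambda>t. \<omega> t (v1 t) - \<eta>1 t * \<psi> t" and ?h2 = "\<lambda>t. \<omega> t (v2 t) - \<eta>2 t * \<psi> t"
  let ?avg = "\<lambda>h T :: real. 1 / (2 * T) * integral {- T..T} h"
  have avg_diff: "?avg ?h1 T - ?avg ?h2 T = 1 / (2 * T) * (g T - g (- T))" if "T > 0" for T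
  proof -
    have I: "((\<lambda>t. ?h1 t - ?h2 t) has_integral g T - g (- T)) {- T..T}"
      using that g by (intro fundamental_theorem_of_calculus)
        (auto simp: has_real_derivative_iff_has_vector_derivative intro: has_vector_derivative_at_within)
    have "?h1 integrable_on {- T..T}" "?h2 integrable_on {- T..T}"
      using integrable by (auto intro!: integrable_continuous_real intro: continuous_on_subset)
    from integral_diff[OF this]
    have "integral {- T..T} ?h1 - integral {- T..T} ?h2 = g T - g (- T)"
      using integral_unique[OF I] by simp
    then show ?thesis
      by (simp flip: diff_divide_distrib)
  qed
  have "\<forall>\<^sub>F T in at_top. norm (?avg ?h1 T - ?avg ?h2 T) \<le> B / T"
  proof (rule eventually_at_top_linorderI[of 1])
    fix T :: real assume "1 \<le> T"
    then have "norm (?avg ?h1 T - ?avg ?h2 T) = \<bar>g T - g (- T)\<bar> / (2 * T)"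
      by (subst avg_diff) (simp_all add: abs_mult)
    also have "\<dots> \<le> (2 * B) / (2 * T)"
      using bounded[of T] bounded[of "- T"] \<open>1 \<le> T\<close> by (intro divide_right_mono) auto
    finally show "norm (?avg ?h1 T - ?avg ?h2 T) \<le> B / T" by simp
  qed
  moreover have "((\<lambda>T. B / T) \<longlongrightarrow> 0) at_top"
    by (intro tendsto_divide_0[OF tendsto_const] filterlim_at_top_imp_at_infinity filterlim_ident)
  ultimately have diff: "((\<lambda>T. ?avg ?h1 T - ?avg ?h2 T) \<longlongrightarrow> 0) at_top"
    by (rule Lim_null_comparison)
  \<comment> \<open>Holding for every \<open>l\<close>, this shows that \<open>None\<close> occurs
    on both sides together and that existing limits agree.\<close>
  have "(?avg ?h1 \<longlongrightarrow> l) at_top \<longleftrightarrow> (?avg ?h2 \<longlongrightarrow> l) at_top" for l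
    using tendsto_diff[OF _ diff, of "?avg ?h1" l] tendsto_add[OF diff, of "?avg ?h2" l] by auto
  then show ?thesis
    unfolding product_orbit_def Topological_Spaces.Lim_def Let_def by simp
qed

context mfd_flow
begin

text \<open>With \<open>v1 - v2 = \<phi> F\<close>, the difference of the integrands has the bounded
  primitive \<open>\<phi> * \<psi>\<close>, by the product rule with derivatives
  \<open>\<eta>2 - \<eta>1\<close> and \<open>\<omega>(F)\<close>.\<close>

lemma product_orbit_eq:
  assumes K: "hyperbolic_attractor M F f K U" "p \<in> K"
    and adj: "(\<omega>, \<psi>) \<in> adjoint_orbit M F (\<lambda>t. f t p)"
    and rel: "((v1, \<eta>1), (v2, \<eta>2)) \<in> shadow_rel_orbit M F f (\<lambda>t. f t p)"
  shows "product_orbit v1 \<eta>1 \<omega> \<psi> = product_orbit v2 \<eta>2 \<omega> \<psi>"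
proof -
  let ?x = "\<lambda>t. f t p"
  have \<omega>: "linear (\<omega> t)" "c \<in> charts M \<Longrightarrow>
      continuous_on {t. ?x t \<in> chart_dom c} (\<lambda>t. \<omega> t (of_coord M c (?x t) a))" for t c a
    using adj by (auto simp: adjoint_orbit_def covfields_orbit_def)
  have \<psi>: "\<psi> \<in> bcontfun" "deriv \<psi> t = \<omega> t (F (?x t))" for t
    using adj by (auto simp: adjoint_orbit_def C1_orbit_def)
  have \<psi>': "(\<psi> has_real_derivative \<omega> t (F (?x t))) (at t)" for t
  proof -
    have "\<psi> differentiable (at t)"
      using adj by (auto simp: adjoint_orbit_def C1_orbit_def C1_differentiable_on_eq)
    then show ?thesis
      using \<psi>(2)[of t] by (metis DERIV_deriv_iff_real_differentiable)
  qed
  have v_bounded: "\<exists>B. \<forall>t. tnorm M (?x t) (v t) \<le> B"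
    and v_differentiable:
      "(\<lambda>s. to_coord M (chart_at M (f t p)) (f (t + s) p) (v (t + s))) differentiable (at 0)"
    and \<omega>v_continuous: "continuous_on UNIV (\<lambda>t. \<omega> t (v t))"
    if v: "v \<in> vfields1_orbit M ?x" for v t
  proof -
    show "\<exists>B. \<forall>t. tnorm M (?x t) (v t) \<le> B"
      using v by (simp add: vfields1_orbit_def)
    have C1: "(\<lambda>t. to_coord M c (?x t) (v t)) C1_differentiable_on {t. ?x t \<in> chart_dom c}"
      if "c \<in> charts M" for c
      using v that by (simp add: vfields1_orbit_def)
    show "(\<lambda>s. to_coord M (chart_at M (f t p)) (f (t + s) p) (v (t + s))) differentiable (at 0)"
      using C1[of "chart_at M (?x t)"]
      by (intro differentiable_shift[where h = "\<lambda>s. to_coord M (chart_at M (f t p)) (f s p) (v s)"])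
         (auto simp: C1_differentiable_on_eq)
    show "continuous_on UNIV (\<lambda>t. \<omega> t (v t))"
      by (rule continuous_on_pairing[where x = ?x])
         (use \<omega> C1_differentiable_imp_continuous_on[OF C1] continuous_on_flow_curve in auto)
  qed
  have v: "v1 \<in> vfields1_orbit M ?x" "v2 \<in> vfields1_orbit M ?x"
    and \<eta>: "\<eta>1 \<in> bcontfun" "\<eta>2 \<in> bcontfun"
    and eq: "\<And>t. lie_orbit M f ?x v1 t + \<eta>1 t *\<^sub>R F (?x t) = lie_orbit M f ?x v2 t + \<eta>2 t *\<^sub>R F (?x t)"
    using rel by (auto simp: shadow_rel_orbit_def shadow_pairs_orbit_def)
  have bcont: "\<exists>C. \<forall>t. \<bar>h t\<bar> \<le> C" "continuous_on UNIV h" if "h \<in> bcontfun" for h :: "real \<Rightarrow> real"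
    using that by (auto simp: bcontfun_def bounded_iff)
  obtain B1 B2 C1 C2 C where
    B: "\<And>t. tnorm M (?x t) (v1 t) \<le> B1" "\<And>t. tnorm M (?x t) (v2 t) \<le> B2"
    and C: "\<And>t. \<bar>\<eta>1 t\<bar> \<le> C1" "\<And>t. \<bar>\<eta>2 t\<bar> \<le> C2" "\<And>t. \<bar>\<psi> t\<bar> \<le> C"
    using v_bounded v bcont(1) \<eta> \<psi>(1) by metis
  obtain \<phi> where \<phi>: "\<And>t. v1 t - v2 t = \<phi> t *\<^sub>R F (?x t)"
    and \<phi>': "\<And>t. (\<phi> has_real_derivative \<eta>2 t - \<eta>1 t) (at t)"
    using equivalent_pairs_differ_by_F[OF K B(1) v_differentiable[OF v(1)] B(2) v_differentiable[OF v(2)]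
        C(1,2) eq] by blast
  obtain D where D: "\<And>q. q \<in> K \<Longrightarrow> inverse (tnorm M q (F q)) \<le> D"
    using inverse_tnorm_F_bounded[OF attractor_compact[OF K(1)] attractor_F_nonzero[OF K(1)]] by blast
  \<comment> \<open>The norm of \<open>\<phi> F\<close> is that of \<open>v1 - v2\<close>; dividing
    by the norm of \<open>F\<close> costs at most a factor \<open>D\<close>.\<close>
  have \<phi>_bounded: "\<bar>\<phi> t\<bar> \<le> (B1 + B2) * D" for t
  proof -
    have K_t: "?x t \<in> K" "tnorm M (?x t) (F (?x t)) > 0"
      using attractor_invariant[OF K] attractor_F_nonzero[OF K(1)] tnorm_pos by blast+
    have le: "tnorm M (?x t) (\<phi> t *\<^sub>R F (?x t)) \<le> B1 + B2"
      using tnorm_triangle_diff[of "?x t" "v1 t" "v2 t"] B[of t] by (simp add: \<phi>)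
    have "\<bar>\<phi> t\<bar> = tnorm M (?x t) (\<phi> t *\<^sub>R F (?x t)) * inverse (tnorm M (?x t) (F (?x t)))"
      using K_t by (simp add: tnorm_scaleR)
    also have "\<dots> \<le> (B1 + B2) * D"
      using le D[OF K_t(1)] K_t(2) tnorm_nonneg[of "?x t"]
      by (intro mult_mono) (auto intro: order_trans[OF tnorm_nonneg])
    finally show ?thesis .
  qed
  show ?thesis
  proof (rule product_orbit_eq_if_difference_exact)
    show "continuous_on UNIV (\<lambda>t. \<omega> t (v1 t) - \<eta>1 t * \<psi> t)"
      "continuous_on UNIV (\<lambda>t. \<omega> t (v2 t) - \<eta>2 t * \<psi> t)"
      using v \<eta> \<psi>(1) by (intro continuous_intros \<omega>v_continuous bcont; simp)+
    show "((\<lambda>t. \<phi> t * \<psi> t) has_real_derivative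
        \<omega> t (v1 t) - \<eta>1 t * \<psi> t - (\<omega> t (v2 t) - \<eta>2 t * \<psi> t)) (at t)" for t
    proof -
      have "\<omega> t (v1 t) - \<omega> t (v2 t) = \<phi> t * \<omega> t (F (?x t))"
        by (simp add: \<phi> linear_scale[OF \<omega>(1)] flip: linear_diff[OF \<omega>(1)])
      then show ?thesis
        using DERIV_mult[OF \<phi>' \<psi>'] by (simp add: algebra_simps)
    qed
    show "\<bar>\<phi> t * \<psi> t\<bar> \<le> (B1 + B2) * D * C" for t
      unfolding abs_mult using \<phi>_bounded[of t] C(3)[of t] by (intro mult_mono) auto
  qed
qed


end


section \<open>The product on the attractor\<close>

lemma set_integrable_continuous_on_compact:
  fixes h :: "'a::t2_space \<Rightarrow> real"
  assumes "compact K" "continuous_on K h" "finite_measure \<rho>" "sets \<rho> = sets borel"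
  shows "set_integrable \<rho> K h"
proof -
  obtain B where B: "\<And>p. p \<in> K \<Longrightarrow> \<bar>h p\<bar> \<le> B"
    using compact_imp_bounded[OF compact_continuous_image[OF assms(2,1)]] by (auto simp: bounded_iff)
  have "(\<lambda>p. indicator K p *\<^sub>R h p) \<in> borel_measurable \<rho>"
    using borel_measurable_continuous_on_indicator[OF borel_compact[OF assms(1)] assms(2)] assms(4)
    by (simp cong: measurable_cong_sets)
  then show ?thesis
    unfolding set_integrable_def
    \<comment> \<open>The maximum with 0 covers the points outside \<open>K\<close>; for empty
      \<open>K\<close> the constant \<open>B\<close> may be negative.\<close>
    by (intro finite_measure.integrable_const_bound[OF assms(3), of _ "max B 0"])
       (use B in \<open>auto simp: indicator_def intro!: le_max_iff_disj[THEN iffD2]\<close>)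
qed

context mfd_flow
begin

text \<open>By invariance, the difference quotients of \<open>g\<close> along the flow have integral zero; on \<open>K\<close> they
  converge boundedly to \<open>h\<close>.\<close>

lemma invariant_integral_derivative_eq_zero:
  assumes K: "hyperbolic_attractor M F f K U"
    and \<rho>: "finite_measure \<rho>" "sets \<rho> = sets borel" "\<And>t. distr \<rho> borel (f t) = \<rho>"
    and g: "continuous_on K g" and h: "continuous_on K h"
    and g': "\<And>p t. p \<in> K \<Longrightarrow> ((\<lambda>t. g (f t p)) has_real_derivative h (f t p)) (at t)"
  shows "(LINT p:K|\<rho>. h p) = 0"
proof -
  note compact = attractor_compact[OF K]
  \<comment> \<open>Extension by zero is measurable on the whole space, while \<open>g\<close> is
    controlled only on \<open>K\<close>.\<close>
  let ?G = "\<lambda>p. indicator K p *\<^sub>R g p :: real"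
  obtain B where B: "\<And>p. p \<in> K \<Longrightarrow> \<bar>h p\<bar> \<le> B"
    using compact_imp_bounded[OF compact_continuous_image[OF h compact]] by (auto simp: bounded_iff)
  have f_measurable: "f t \<in> measurable \<rho> borel" for t
    using borel_measurable_continuous_onI[OF continuous_on_flow_map[of UNIV t]] \<rho>(2)
    by (simp cong: measurable_cong_sets)
  \<comment> \<open>Invariance in both time directions makes the indicator of \<open>K\<close>
    constant along orbits.\<close>
  have in_K: "f t p \<in> K \<longleftrightarrow> p \<in> K" for t p
    using attractor_invariant[OF K, of p t] attractor_invariant[OF K, of "f t p" "- t"] by auto
  have G: "integrable \<rho> ?G" "?G \<in> borel_measurable borel"
    using set_integrable_continuous_on_compact[OF compact g \<rho>(1,2)]
      borel_measurable_continuous_on_indicator[OF borel_compact[OF compact] g]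
    by (simp_all add: set_integrable_def)
  have shift: "integrable \<rho> (\<lambda>p. ?G (f t p))" "(\<integral>p. ?G (f t p) \<partial>\<rho>) = (\<integral>p. ?G p \<partial>\<rho>)" for t
    using integrable_distr_eq[OF f_measurable G(2), of t] integral_distr[OF f_measurable G(2), of t]
      G(1) \<rho>(3)[of t] by simp_all
  \<comment> \<open>Difference quotients along the flow with step \<open>1 / (n + 1)\<close>; the
    shift by one keeps every step positive.\<close>
  define q where "q n p = real (Suc n) * (?G (f (inverse (real (Suc n))) p) - ?G p)" for n p
  have "(\<lambda>n. \<integral>p. q n p \<partial>\<rho>) \<longlonglongrightarrow> (\<integral>p. indicator K p *\<^sub>R h p \<partial>\<rho>)"
  proof (rule integral_dominated_convergence[where w = "\<lambda>p. max B 0"])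
    show "(\<lambda>p. indicator K p *\<^sub>R h p) \<in> borel_measurable \<rho>"
      using set_integrable_continuous_on_compact[OF compact h \<rho>(1,2)]
      by (simp add: set_integrable_def borel_measurable_integrable)
    show "q n \<in> borel_measurable \<rho>" for n
      unfolding q_def using shift(1) G(1) by (intro borel_measurable_integrable) simp
    show "integrable \<rho> (\<lambda>p. max B 0)"
      using \<rho>(1) by (simp add: finite_measure.integrable_const)
    show "AE p in \<rho>. (\<lambda>n. q n p) \<longlonglongrightarrow> indicator K p *\<^sub>R h p"
    proof (rule AE_I2)
      fix p
      show "(\<lambda>n. q n p) \<longlonglongrightarrow> indicator K p *\<^sub>R h p"
      proof (cases "p \<in> K")
        case True
        have "(\<lambda>t. (g (f (0 + t) p) - g (f 0 p)) / t) \<midarrow>0\<rightarrow> h (f 0 p)"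
          using g'[OF True, of 0] unfolding DERIV_def .
        moreover have "filterlim (\<lambda>n. inverse (real (Suc n))) (at 0) sequentially"
          using LIMSEQ_inverse_real_of_nat by (auto simp: filterlim_at)
        ultimately have
          "(\<lambda>n. (g (f (0 + inverse (real (Suc n))) p) - g (f 0 p)) / inverse (real (Suc n))) \<longlonglongrightarrow> h (f 0 p)"
          by (rule filterlim_compose)
        then show ?thesis
          using True by (simp add: q_def in_K field_simps)
      qed (simp add: q_def in_K)
    qed
    \<comment> \<open>Mean value inequality along the orbit, with \<open>B\<close> bounding the
      derivative \<open>h\<close> on \<open>K\<close>.\<close>
    show "AE p in \<rho>. norm (q n p) \<le> max B 0" for n
    proof (rule AE_I2)
      fix p
      show "norm (q n p) \<le> max B 0"
      proof (cases "p \<in> K")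
        case True
        let ?t = "inverse (real (Suc n))"
        have "norm (g (f ?t p) - g (f 0 p)) \<le> B * norm (?t - 0)"
          by (rule field_differentiable_bound[of UNIV "\<lambda>t. g (f t p)" "\<lambda>t. h (f t p)"])
             (use g'[OF True] B True in_K in auto)
        then have "real (Suc n) * \<bar>g (f ?t p) - g p\<bar> \<le> real (Suc n) * (B * ?t)"
          by (intro mult_left_mono) auto
        also have "\<dots> = B" by simp
        finally show ?thesis
          using True by (simp add: q_def in_K abs_mult)
      qed (simp add: q_def in_K)
    qed
  qed
  moreover have "(\<integral>p. q n p \<partial>\<rho>) = 0" for n
    unfolding q_def using shift G(1) by simp
  ultimately show ?thesis
    by (simp add: set_lebesgue_integral_def LIMSEQ_const_iff)
qed

text \<open>The orbit argument applies through every point of \<open>K\<close>; the additional task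
  is to fit the coefficients found on separate orbits into one continuous function on
  \<open>K\<close>, so that \<open>\<phi> * \<psi>\<close> can be integrated.\<close>

lemma product_attractor_eq:
  assumes K: "hyperbolic_attractor M F f K U" and \<rho>: "physical_measure M f K U \<rho>" and \<alpha>: "\<alpha> > 0"
    and adj: "(\<omega>, \<psi>) \<in> adjoint_attractor M F f \<alpha> K"
    and rel: "((v1, \<eta>1), (v2, \<eta>2)) \<in> shadow_rel_attractor M F f \<alpha> K"
  shows "product_attractor \<rho> K v1 \<eta>1 \<omega> \<psi> = product_attractor \<rho> K v2 \<eta>2 \<omega> \<psi>"
proof -
  note compact = attractor_compact[OF K] and invariant = attractor_invariant[OF K]
  note fun_cont = holder_fun_continuous_on[OF compact \<alpha>]
  have \<rho>_finite: "finite_measure \<rho>" and \<rho>_sets: "sets \<rho> = sets borel"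
    and \<rho>_inv: "distr \<rho> borel (f t) = \<rho>" for t
    using \<rho> sets_eq_imp_space_eq[of \<rho> borel]
    by (auto simp: physical_measure_def intro!: finite_measureI)
  have \<omega>: "\<omega> \<in> holder_covfields M \<alpha> K" "p \<in> K \<Longrightarrow> linear (\<omega> p)" for p
    using adj by (auto simp: adjoint_attractor_def holder_covfields_def)
  have \<psi>: "\<psi> \<in> holder_fun M \<alpha> K" "deriv_along f \<psi> \<in> holder_fun M \<alpha> K"
    using adj by (auto simp: adjoint_attractor_def)
  have add: "f s (f t p) = f (t + s) p" for s t p
    by (simp add: add.commute flip: flow_add)
  \<comment> \<open>The derivative is given only at time 0, but at every point of \<open>K\<close>;
    using it at \<open>f t p\<close> and shifting time reaches all \<open>t\<close>.\<close>
  have \<psi>': "((\<lambda>t. \<psi> (f t p)) has_real_derivative \<omega> (f t p) (F (f t p))) (at t)" if "p \<in> K" for p t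
  proof -
    have "((\<lambda>s. \<psi> (f s (f t p))) has_real_derivative \<omega> (f t p) (F (f t p))) (at 0)"
      using adj invariant[OF that, of t] DERIV_deriv_iff_real_differentiable[of "fun_along f \<psi> (f t p)" 0]
      by (auto simp: adjoint_attractor_def deriv_along_def fun_along_def)
    then show ?thesis
      using DERIV_shift[of "\<lambda>t. \<psi> (f t p)" _ 0 t] by (simp add: add add.commute)
  qed
  have v: "v1 \<in> holder_vfields M \<alpha> K" "v2 \<in> holder_vfields M \<alpha> K"
    and \<eta>: "\<eta>1 \<in> holder_fun M \<alpha> K" "\<eta>2 \<in> holder_fun M \<alpha> K"
    and eq: "\<And>p. p \<in> K \<Longrightarrow> lie_along M f v1 p + \<eta>1 p *\<^sub>R F p = lie_along M f v2 p + \<eta>2 p *\<^sub>R F p"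
    and v_diff: "\<And>p. p \<in> K \<Longrightarrow> vfield_along M f v1 p differentiable (at 0)"
      "\<And>p. p \<in> K \<Longrightarrow> vfield_along M f v2 p differentiable (at 0)"
    using rel by (auto simp: shadow_rel_attractor_def shadow_pairs_attractor_def)
  note v_cont = holder_vfields_continuous_on[OF compact \<alpha> v(1)]
    holder_vfields_continuous_on[OF compact \<alpha> v(2)]
  obtain B1 where B1: "\<And>p. p \<in> K \<Longrightarrow> tnorm M p (v1 p) \<le> B1"
    using bounded_tnorm_on_compact[OF compact v_cont(1)] by blast
  obtain B2 where B2: "\<And>p. p \<in> K \<Longrightarrow> tnorm M p (v2 p) \<le> B2"
    using bounded_tnorm_on_compact[OF compact v_cont(2)] by blast
  have "\<exists>C. \<forall>p\<in>K. \<bar>\<eta> p\<bar> \<le> C" if "\<eta> \<in> holder_fun M \<alpha> K" for \<eta>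
    using compact_imp_bounded[OF compact_continuous_image[OF fun_cont[OF that] compact]]
    by (auto simp: bounded_iff)
  with \<eta> obtain C1 C2 where C: "\<And>p. p \<in> K \<Longrightarrow> \<bar>\<eta>1 p\<bar> \<le> C1" "\<And>p. p \<in> K \<Longrightarrow> \<bar>\<eta>2 p\<bar> \<le> C2"
    by meson
  \<comment> \<open>The metric formula for the coefficient of \<open>F\<close> defines one function
    on all of \<open>K\<close> whose continuity follows from that of the fields.\<close>
  define \<phi> where "\<phi> p = (metric M p (v1 p) (F p) - metric M p (v2 p) (F p)) / metric M p (F p) (F p)" for p
  have \<phi>: "v1 p - v2 p = \<phi> p *\<^sub>R F p"
    and \<phi>': "((\<lambda>t. \<phi> (f t p)) has_real_derivative \<eta>2 (f t p) - \<eta>1 (f t p)) (at t)" if p: "p \<in> K" for p t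
  proof -
    obtain \<phi>p where \<phi>p: "\<And>t. v1 (f t p) - v2 (f t p) = \<phi>p t *\<^sub>R F (f t p)"
      and \<phi>p': "\<And>t. (\<phi>p has_real_derivative \<eta>2 (f t p) - \<eta>1 (f t p)) (at t)"
    proof (rule equivalent_pairs_differ_by_F[OF K p, of "\<lambda>t. v1 (f t p)" B1 "\<lambda>t. v2 (f t p)" B2
          "\<lambda>t. \<eta>1 (f t p)" C1 "\<lambda>t. \<eta>2 (f t p)" C2])
      fix t
      note K_t = invariant[OF p, of t]
      show "tnorm M (f t p) (v1 (f t p)) \<le> B1" "tnorm M (f t p) (v2 (f t p)) \<le> B2"
        "\<bar>\<eta>1 (f t p)\<bar> \<le> C1" "\<bar>\<eta>2 (f t p)\<bar> \<le> C2"
        using B1 B2 C K_t by auto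
      show "(\<lambda>s. to_coord M (chart_at M (f t p)) (f (t + s) p) (v1 (f (t + s) p))) differentiable (at 0)"
        "(\<lambda>s. to_coord M (chart_at M (f t p)) (f (t + s) p) (v2 (f (t + s) p))) differentiable (at 0)"
        using v_diff[OF K_t] by (simp_all add: vfield_along_def add)
      show "lie_orbit M f (\<lambda>t. f t p) (\<lambda>t. v1 (f t p)) t + \<eta>1 (f t p) *\<^sub>R F (f t p) =
          lie_orbit M f (\<lambda>t. f t p) (\<lambda>t. v2 (f t p)) t + \<eta>2 (f t p) *\<^sub>R F (f t p)"
        using eq[OF K_t] by (simp add: lie_along_eq_lie_orbit)
    qed blast
    \<comment> \<open>Pairing the orbitwise identity with \<open>F\<close> identifies its
      coefficient with the global one.\<close>
    have \<phi>_eq: "\<phi> (f t p) = \<phi>p t" for t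
    proof -
      have "metric M (f t p) (F (f t p)) (F (f t p)) \<noteq> 0"
        using metric_pos attractor_F_nonzero[OF K] invariant[OF p] by (metis less_irrefl)
      then show ?thesis
        by (simp add: \<phi>_def \<phi>p bilinear_lmul[OF bilinear_metric]
            flip: bilinear_lsub[OF bilinear_metric])
    qed
    show "v1 p - v2 p = \<phi> p *\<^sub>R F p"
      using \<phi>p[of 0] \<phi>_eq[of 0] by simp
    show "((\<lambda>t. \<phi> (f t p)) has_real_derivative \<eta>2 (f t p) - \<eta>1 (f t p)) (at t)"
      using \<phi>p' by (simp add: \<phi>_eq)
  qed
  have \<phi>_cont: "continuous_on K \<phi>"
    unfolding \<phi>_def using attractor_F_nonzero[OF K] metric_pos
    by (intro continuous_on_divide continuous_on_diff continuous_on_metric continuous_on_F v_cont)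
       (auto simp: less_le)
  let ?h = "\<lambda>p. (\<omega> p (v1 p) - \<eta>1 p * \<psi> p) - (\<omega> p (v2 p) - \<eta>2 p * \<psi> p)"
  note cont = holder_pairing_continuous_on[OF compact \<alpha> _ \<omega>(1)] fun_cont
  note integrable = set_integrable_continuous_on_compact[OF compact _ \<rho>_finite \<rho>_sets]
  have "(LINT p:K|\<rho>. ?h p) = 0"
  proof (rule invariant_integral_derivative_eq_zero[OF K \<rho>_finite \<rho>_sets \<rho>_inv])
    show "continuous_on K (\<lambda>p. \<phi> p * \<psi> p)"
      using \<phi>_cont fun_cont[OF \<psi>(1)] by (rule continuous_on_mult)
    show "continuous_on K ?h"
      using v \<eta> \<psi> by (intro continuous_on_diff continuous_on_mult cont)
    fix p t assume p: "p \<in> K"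
    have "\<omega> (f t p) (v1 (f t p)) - \<omega> (f t p) (v2 (f t p)) = \<phi> (f t p) * \<omega> (f t p) (F (f t p))"
      using \<phi>[OF invariant[OF p, of t]] \<omega>(2)[OF invariant[OF p, of t]]
      by (simp add: linear_scale flip: linear_diff)
    then show "((\<lambda>t. \<phi> (f t p) * \<psi> (f t p)) has_real_derivative ?h (f t p)) (at t)"
      using DERIV_mult[OF \<phi>'[OF p] \<psi>'[OF p]] by (simp add: algebra_simps)
  qed
  \<comment> \<open>The integral may be split because all four terms are continuous on the compact
    set \<open>K\<close>, hence integrable.\<close>
  moreover have "(LINT p:K|\<rho>. ?h p) =
      ((LINT p:K|\<rho>. \<omega> p (v1 p)) - (LINT p:K|\<rho>. \<eta>1 p * \<psi> p)) -
      ((LINT p:K|\<rho>. \<omega> p (v2 p)) - (LINT p:K|\<rho>. \<eta>2 p * \<psi> p))"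
    using v \<eta> \<psi> by (simp add: set_integral_diff integrable continuous_on_diff continuous_on_mult cont)
  ultimately show ?thesis
    by (simp add: product_attractor_def)
qed

end

section \<open>Passage to equivalence classes\<close>

lemma constant_onI: "(\<And>y z. y \<in> c \<Longrightarrow> z \<in> c \<Longrightarrow> h y = h z) \<Longrightarrow> h constant_on c"
  unfolding constant_on_def by (cases "c = {}") blast+

theorem lemma5:
  fixes M :: "('m::{t2_space, second_countable_topology}, 'e::euclidean_space) riemannian"
    and F :: "'m \<Rightarrow> 'e"
    and f :: "real \<Rightarrow> 'm \<Rightarrow> 'm"
    and K U :: "'m set"
  assumes "riemannian_manifold M"
    and "smooth_vector_field M F"
    and "flow_of M F f"
    and "hyperbolic_attractor M F f K U"
  shows
    "(\<forall>x\<in>orbits_on f K. \<forall>(\<omega>, \<psi>)\<in>adjoint_orbit M F x.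
        (\<forall>c\<in>A_orbit M F f x. (\<lambda>(v, \<eta>). product_orbit v \<eta> \<omega> \<psi>) constant_on c) \<and>
        (\<forall>X\<in>vfields_orbit M x.
           (\<lambda>(v, \<eta>). product_orbit v \<eta> \<omega> \<psi>) constant_on (S_orbit M F f x X)))
     \<and>
     (\<forall>\<rho> \<alpha>. mixing_axiom_A_attractor M F f K U \<and> physical_measure M f K U \<rho> \<and> 0 < \<alpha> \<and> \<alpha> \<le> 1 \<longrightarrow>
        (\<forall>(\<omega>, \<psi>)\<in>adjoint_attractor M F f \<alpha> K.
           (\<forall>c\<in>A_attractor M F f \<alpha> K.
              (\<lambda>(v, \<eta>). product_attractor \<rho> K v \<eta> \<omega> \<psi>) constant_on c) \<and>
           (\<forall>X\<in>holder_vfields M \<alpha> K.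
              (\<lambda>(v, \<eta>). product_attractor \<rho> K v \<eta> \<omega> \<psi>) constant_on (S_attractor M F f \<alpha> K X))))"
proof -
  interpret mfd_flow M F f
    using assms(1-3) by unfold_locales
  show ?thesis
  proof (intro conjI ballI allI impI, goal_cases)
    case (1 x a)
    then obtain p where p: "p \<in> K" and x: "x = (\<lambda>t. f t p)"
      by (auto simp: orbits_on_def)
    obtain \<omega> \<psi> where a: "a = (\<omega>, \<psi>)" by (cases a)
    have eq: "(\<lambda>(v, \<eta>). product_orbit v \<eta> \<omega> \<psi>) y = (\<lambda>(v, \<eta>). product_orbit v \<eta> \<omega> \<psi>) z"
      if "(y, z) \<in> shadow_rel_orbit M F f x" for y z
      using product_orbit_eq[OF assms(4) p] 1(2) that unfolding x a by (cases y, cases z) auto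
    have "(\<lambda>(v, \<eta>). product_orbit v \<eta> \<omega> \<psi>) constant_on c" if "c \<in> A_orbit M F f x" for c
      using quotient_eq_iff[OF equiv_shadow_rel_orbit that[unfolded A_orbit_def] that[unfolded A_orbit_def]] eq
      by (intro constant_onI) blast
    \<comment> \<open>Two solutions with the same right-hand side \<open>X\<close> are equivalent by
      the definition of the relation.\<close>
    moreover have "(\<lambda>(v, \<eta>). product_orbit v \<eta> \<omega> \<psi>) constant_on (S_orbit M F f x X)" for X
      by (intro constant_onI eq) (auto simp: S_orbit_def shadow_rel_orbit_def)
    ultimately show ?case by (simp add: a)
  next
    case (2 \<rho> \<alpha> a)
    obtain \<omega> \<psi> where a: "a = (\<omega>, \<psi>)" by (cases a)
    have eq: "(\<lambda>(v, \<eta>). product_attractor \<rho> K v \<eta> \<omega> \<psi>) y = (\<lambda>(v, \<eta>). product_attractor \<rho> K v \<eta> \<omega> \<psi>) z"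
      if "(y, z) \<in> shadow_rel_attractor M F f \<alpha> K" for y z
      using product_attractor_eq[OF assms(4)] 2 that unfolding a by (cases y, cases z) auto
    have "(\<lambda>(v, \<eta>). product_attractor \<rho> K v \<eta> \<omega> \<psi>) constant_on c" if "c \<in> A_attractor M F f \<alpha> K" for c
      using quotient_eq_iff[OF equiv_shadow_rel_attractor that[unfolded A_attractor_def] that[unfolded A_attractor_def]] eq
      by (intro constant_onI) blast
    moreover have "(\<lambda>(v, \<eta>). product_attractor \<rho> K v \<eta> \<omega> \<psi>) constant_on (S_attractor M F f \<alpha> K X)" for X
      by (intro constant_onI eq) (auto simp: S_attractor_def shadow_rel_attractor_def)
    ultimately show ?case by (simp add: a)
  qed
qed

end
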